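(* Let $\mathcal G$ be a finite connected compact metric graph with length vector $\ell\in(0,\infty)^{\mathcal E}$, Kirchhoff conditions at interior vertices and a fixed Dirichlet or Neumann condition at each exterior vertex. Let $K\subsetneq\mathcal G$ be a proper simple cycle or a proper simple path joining two exterior vertices (each of the two endpoints of the path may independently carry a Dirichlet or a Neumann condition). If $\operatorname{RAC}(K,\ell)$ holds, i.e. $H_\ell\cap\mathcal R_K\neq\varnothing$, then there exist frequencies $k_n\to\infty$ and eigenfunctions $u_n$ of $-\Delta_{\mathcal G,\ell}$ with $\|u_n\|_{L^2(\mathcal G)}=1$ such that $$-\Delta_{\mathcal G,\ell}u_n=k_n^2u_n,\qquad \|u_n\|_{L^2(\mathcal G\setminus K)}\longrightarrow0,\qquad |u_n|^2\,dx\rightharpoonup\frac1{L_K}\,dx\big|_K ,$$ where $L_K=\sum_{e\subset K}\ell_e$ and $\rightharpoonup$ denotes weak convergence of measures on $\mathcal G$.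
   Context: Setting. $\mathcal G=(\mathcal V,\mathcal E,\ell)$: finite connected graph (loops and parallel edges allowed), each edge $e$ identified with $[0,\ell_e]$, $\ell_e>0$. A vertex is exterior if it has degree one (loops count twice), interior otherwise. $L^2(\mathcal G)=\bigoplus_{e}L^2(0,\ell_e)$. $-\Delta_{\mathcal G,\ell}$ is the self-adjoint operator acting as $-u''$ on each edge, on edgewise $H^2$ functions that at each interior vertex are continuous and have vanishing sum of normal derivatives (Kirchhoff), and at each exterior vertex $v$ satisfy the fixed prescribed condition, $u(v)=0$ (Dirichlet) or $\partial_\nu u(v)=0$ (Neumann). A loop is a one-edge simple cycle, and two parallel edges may form a two-edge simple cycle. A primitive subgraph is a simple cycle or a simple path joining two exterior vertices; it is proper if it is not all of $\mathcal G$. Secular objects. $\mathbb T=\mathbb R/2\pi\mathbb Z$. Let $\mathcal B$ be the set of directed bonds (each edge $e$ gives two, $(e,+)$ and $(e,-)$, reverses of each other). Let $S_B$ be the unitary matrix on $\mathbb C^{\mathcal B}$ with $(S_Ba)_b=\sum_{b'}\sigma_{bb'}a_{b'}$, the sum over bonds $b'$ ending at the initial vertex $v$ of $b$; if $v$ is interior of degree $d$, $\sigma_{bb'}=2/d-1$ if $b'$ is the reverse of $b$ and $2/d$ otherwise; if $v$ is exterior, $\sigma_{bb'}=-1$ (Dirichlet) or $+1$ (Neumann). For $\theta\in\mathbb T^{\mathcal E}$, $D(\theta)$ is the diagonal matrix with entry $e^{i\theta_e}$ on both bonds of $e$, and $U_B(\theta)=D(\theta)S_B$. Set $I_e(a)=|a_{e,+}|^2+|a_{e,-}|^2$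 and $Z_B=\{\theta\in\mathbb T^{\mathcal E}:\det(I-U_B(\theta))=0\}$. For a proper primitive $K$, $\mathcal R_K\subset Z_B$ is the set of $\theta$ for which $1$ is a simple eigenvalue of $U_B(\theta)$ and its eigenvector $a$ is supported exactly on $K$ ($I_e(a)>0$ iff $e\subset K$). Arithmetic. $H_\ell=\overline{\{[k\ell]:k\in\mathbb R\}}\subset\mathbb T^{\mathcal E}$. $\operatorname{RAC}(K,\ell)$ means $H_\ell\cap\mathcal R_K\ne\varnothing$. *)

theory Defs
  imports "HOL-Analysis.Analysis"
begin

section \<open>Metric graphs\<close>

datatype boundary_condition = Dirichlet | Neumann

text \<open>Loops and parallel edges are allowed. The edge \<open>e\<close> is identified with \<open>[0, len G e]\<close> so that
  \<open>0\<close> is the end at \<open>src G e\<close> and \<open>len G e\<close> the end at \<open>tgt G e\<close>; the orientation has no other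
  meaning. Only the values of \<open>bcond G\<close> at exterior vertices are ever used.\<close>

record ('v, 'e) quantum_graph =
  src :: "'e \<Rightarrow> 'v"
  tgt :: "'e \<Rightarrow> 'v"
  len :: "'e \<Rightarrow> real"
  bcond :: "'v \<Rightarrow> boundary_condition"

definition connected_graph :: "('v, 'e) quantum_graph \<Rightarrow> bool" where
  "connected_graph G \<longleftrightarrow>
     (\<forall>v w. (v, w) \<in> ({(src G e, tgt G e) | e. True} \<union> {(tgt G e, src G e) | e. True})\<^sup>*)"

definition metric_graph :: "('v::finite, 'e::finite) quantum_graph \<Rightarrow> bool" where
  "metric_graph G \<longleftrightarrow> connected_graph G \<and> (\<forall>e. 0 < len G e)"

text \<open>The directed bond \<open>(e, True)\<close> runs from \<open>src G e\<close> to \<open>tgt G e\<close>, and \<open>(e, False)\<close> is its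
  reverse.\<close>

type_synonym 'e bond = "'e \<times> bool"

definition origin :: "('v, 'e) quantum_graph \<Rightarrow> 'e bond \<Rightarrow> 'v" where
  "origin G b = (if snd b then src G (fst b) else tgt G (fst b))"

definition terminus :: "('v, 'e) quantum_graph \<Rightarrow> 'e bond \<Rightarrow> 'v" where
  "terminus G b = (if snd b then tgt G (fst b) else src G (fst b))"

definition rev_bond :: "'e bond \<Rightarrow> 'e bond" where
  "rev_bond b = (fst b, \<not> snd b)"

text \<open>A loop at \<open>v\<close> gives two bonds with origin \<open>v\<close>, hence counts twice.\<close>

definition vertex_degree :: "('v, 'e::finite) quantum_graph \<Rightarrow> 'v \<Rightarrow> nat" where
  "vertex_degree G v = card {b. origin G b = v}"

definition exterior :: "('v, 'e::finite) quantum_graph \<Rightarrow> 'v \<Rightarrow> bool" where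
  "exterior G v \<longleftrightarrow> vertex_degree G v = 1"


section \<open>Primitive subgraphs\<close>

text \<open>Subgraphs without isolated vertices are given by their sets of edges.\<close>

definition bond_walk :: "('v, 'e) quantum_graph \<Rightarrow> 'e bond list \<Rightarrow> bool" where
  "bond_walk G bs \<longleftrightarrow>
     bs \<noteq> [] \<and> (\<forall>i. Suc i < length bs \<longrightarrow> terminus G (bs ! i) = origin G (bs ! Suc i))"

text \<open>Distinctness of the edges excludes the closed walk \<open>[b, rev_bond b]\<close>, while loops and pairs
  of parallel edges are admitted.\<close>

definition simple_cycle :: "('v, 'e) quantum_graph \<Rightarrow> 'e set \<Rightarrow> bool" where
  "simple_cycle G K \<longleftrightarrow>
     (\<exists>bs. bond_walk G bs \<and> terminus G (last bs) = origin G (hd bs) \<and>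
        distinct (map (origin G) bs) \<and> distinct (map fst bs) \<and> K = fst ` set bs)"

definition simple_exterior_path :: "('v, 'e::finite) quantum_graph \<Rightarrow> 'e set \<Rightarrow> bool" where
  "simple_exterior_path G K \<longleftrightarrow>
     (\<exists>bs. bond_walk G bs \<and> distinct (map (origin G) bs @ [terminus G (last bs)]) \<and>
        exterior G (origin G (hd bs)) \<and> exterior G (terminus G (last bs)) \<and> K = fst ` set bs)"

definition primitive_subgraph :: "('v, 'e::finite) quantum_graph \<Rightarrow> 'e set \<Rightarrow> bool" where
  "primitive_subgraph G K \<longleftrightarrow> simple_cycle G K \<or> simple_exterior_path G K"


section \<open>The Laplacian\<close>

text \<open>\<open>H2_edge L f f1 f2\<close>: \<open>f\<close> is the continuously differentiable representative on \<open>[0, L]\<close> of an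
  element of the Sobolev space \<open>H\<^sup>2(0, L)\<close>, with first derivative \<open>f1\<close> and second (weak)
  derivative \<open>f2\<close> in \<open>L\<^sup>2(0, L)\<close>, determined almost everywhere.\<close>

definition H2_edge :: "real \<Rightarrow> (real \<Rightarrow> complex) \<Rightarrow> (real \<Rightarrow> complex) \<Rightarrow> (real \<Rightarrow> complex) \<Rightarrow> bool" where
  "H2_edge L f f1 f2 \<longleftrightarrow>
     set_borel_measurable lborel {0..L} f2 \<and>
     set_integrable lborel {0..L} (\<lambda>x. (cmod (f2 x))\<^sup>2) \<and>
     (\<forall>x\<in>{0..L}. f1 x = f1 0 + (LINT t:{0..x}|lborel. f2 t)) \<and>
     (\<forall>x\<in>{0..L}. f x = f 0 + (LINT t:{0..x}|lborel. f1 t))"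

text \<open>Boundary value, respectively outgoing normal derivative, at the origin of a bond.\<close>

definition vertex_value :: "('v, 'e) quantum_graph \<Rightarrow> ('e \<Rightarrow> real \<Rightarrow> complex) \<Rightarrow> 'e bond \<Rightarrow> complex" where
  "vertex_value G u b = (if snd b then u (fst b) 0 else u (fst b) (len G (fst b)))"

definition normal_deriv :: "('v, 'e) quantum_graph \<Rightarrow> ('e \<Rightarrow> real \<Rightarrow> complex) \<Rightarrow> 'e bond \<Rightarrow> complex" where
  "normal_deriv G u1 b = (if snd b then u1 (fst b) 0 else - u1 (fst b) (len G (fst b)))"

definition vertex_condition ::
  "('v, 'e::finite) quantum_graph \<Rightarrow> ('e \<Rightarrow> real \<Rightarrow> complex) \<Rightarrow> ('e \<Rightarrow> real \<Rightarrow> complex) \<Rightarrow> 'v \<Rightarrow> bool" where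
  "vertex_condition G u u1 v \<longleftrightarrow>
     (if exterior G v then
        (case bcond G v of
           Dirichlet \<Rightarrow> \<forall>b. origin G b = v \<longrightarrow> vertex_value G u b = 0
         | Neumann \<Rightarrow> \<forall>b. origin G b = v \<longrightarrow> normal_deriv G u1 b = 0)
      else
        (\<forall>b b'. origin G b = v \<and> origin G b' = v \<longrightarrow> vertex_value G u b = vertex_value G u b') \<and>
        (\<Sum>b | origin G b = v. normal_deriv G u1 b) = 0)"

text \<open>The graph of the operator: \<open>u\<close> lies in the domain and \<open>w = - u''\<close> edgewise. It relates
  \<open>u\<close> to every representative \<open>w\<close> of the class of \<open>- u''\<close> in \<open>L\<^sup>2\<close>.\<close>

definition neg_laplacian ::
  "('v, 'e::finite) quantum_graph \<Rightarrow> ('e \<Rightarrow> real \<Rightarrow> complex) \<Rightarrow> ('e \<Rightarrow> real \<Rightarrow> complex) \<Rightarrow> bool" where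
  "neg_laplacian G u w \<longleftrightarrow>
     (\<exists>u1. (\<forall>e. H2_edge (len G e) (u e) (u1 e) (\<lambda>x. - w e x)) \<and> (\<forall>v. vertex_condition G u u1 v))"

text \<open>The \<open>L\<^sup>2\<close> norm over the union of the edges in \<open>F\<close>.\<close>

definition L2_norm :: "('v, 'e::finite) quantum_graph \<Rightarrow> 'e set \<Rightarrow> ('e \<Rightarrow> real \<Rightarrow> complex) \<Rightarrow> real" where
  "L2_norm G F u = sqrt (\<Sum>e\<in>F. LINT x:{0..len G e}|lborel. (cmod (u e x))\<^sup>2)"

definition eigenfunction ::
  "('v, 'e::finite) quantum_graph \<Rightarrow> real \<Rightarrow> ('e \<Rightarrow> real \<Rightarrow> complex) \<Rightarrow> bool" where
  "eigenfunction G \<mu> u \<longleftrightarrow>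
     neg_laplacian G u (\<lambda>e x. complex_of_real \<mu> * u e x) \<and> L2_norm G UNIV u \<noteq> 0"


section \<open>Measures on a metric graph\<close>

datatype ('v, 'e) graph_point = Vertex 'v | Inner 'e real

definition edge_point :: "('v, 'e) quantum_graph \<Rightarrow> 'e \<Rightarrow> real \<Rightarrow> ('v, 'e) graph_point" where
  "edge_point G e x =
     (if x = 0 then Vertex (src G e) else if x = len G e then Vertex (tgt G e) else Inner e x)"

definition graph_points :: "('v, 'e) quantum_graph \<Rightarrow> ('v, 'e) graph_point set" where
  "graph_points G = range Vertex \<union> {Inner e x | e x. 0 < x \<and> x < len G e}"

lemma edge_point_in_graph_points: "x \<in> {0..len G e} \<Longrightarrow> edge_point G e x \<in> graph_points G"
  by (cases "x = 0"; cases "x = len G e") (simp_all add: edge_point_def graph_points_def)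

text \<open>The quotient topology of the disjoint union of the intervals \<open>[0, len G e]\<close>.\<close>

definition graph_topology :: "('v, 'e) quantum_graph \<Rightarrow> ('v, 'e) graph_point topology" where
  "graph_topology G = topology (\<lambda>U. U \<subseteq> graph_points G \<and>
     (\<forall>e. openin (top_of_set {0..len G e}) {x \<in> {0..len G e}. edge_point G e x \<in> U}))"

lemma openin_graph_topology:
  "openin (graph_topology G) U \<longleftrightarrow> U \<subseteq> graph_points G \<and>
     (\<forall>e. openin (top_of_set {0..len G e}) {x \<in> {0..len G e}. edge_point G e x \<in> U})"
proof -
  let ?P = "\<lambda>U. U \<subseteq> graph_points G \<and>
     (\<forall>e. openin (top_of_set {0..len G e}) {x \<in> {0..len G e}. edge_point G e x \<in> U})"
  have "istopology ?P"
    unfolding istopology_def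
  proof (intro conjI allI impI)
    fix S T assume S: "?P S" and T: "?P T"
    show "S \<inter> T \<subseteq> graph_points G" using S by blast
    fix e
    have eq: "{x \<in> {0..len G e}. edge_point G e x \<in> S \<inter> T} =
        {x \<in> {0..len G e}. edge_point G e x \<in> S} \<inter> {x \<in> {0..len G e}. edge_point G e x \<in> T}"
      by blast
    show "openin (top_of_set {0..len G e}) {x \<in> {0..len G e}. edge_point G e x \<in> S \<inter> T}"
      unfolding eq using S T by (intro openin_Int) blast+
  next
    fix \<K> assume *: "\<forall>S\<in>\<K>. ?P S"
    then show "\<Union>\<K> \<subseteq> graph_points G" by blast
    fix e
    have eq: "{x \<in> {0..len G e}. edge_point G e x \<in> \<Union>\<K>} =
        \<Union>((\<lambda>S. {x \<in> {0..len G e}. edge_point G e x \<in> S}) ` \<K>)"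
      by blast
    show "openin (top_of_set {0..len G e}) {x \<in> {0..len G e}. edge_point G e x \<in> \<Union>\<K>}"
      unfolding eq by (rule openin_Union) (use * in blast)
  qed
  then show ?thesis
    by (simp add: graph_topology_def topology_inverse')
qed

lemma topspace_graph_topology [simp]: "topspace (graph_topology G) = graph_points G"
proof -
  have "{x \<in> {0..len G e}. edge_point G e x \<in> graph_points G} = {0..len G e}" for e
    using edge_point_in_graph_points[of _ G e] by (intro equalityI subsetI CollectI conjI) simp_all
  then have "openin (graph_topology G) (graph_points G)"
    by (simp add: openin_graph_topology)
  moreover have "topspace (graph_topology G) \<subseteq> graph_points G"
    using openin_graph_topology[of G "topspace (graph_topology G)"] by simp
  ultimately show ?thesis
    by (simp add: openin_subset subset_antisym)
qed

definition borel_of_topology :: "'a topology \<Rightarrow> 'a measure" where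
  "borel_of_topology X = sigma (topspace X) {U. openin X U}"

text \<open>Lebesgue measure on the disjoint union of the intervals \<open>[0, len G e]\<close>, and the Borel measure
  \<open>\<rho> dx\<close> on the graph with edgewise density \<open>\<rho>\<close>.\<close>

definition edges_lborel :: "('v, 'e::finite) quantum_graph \<Rightarrow> ('e \<times> real) measure" where
  "edges_lborel G =
     restrict_space (count_space UNIV \<Otimes>\<^sub>M lborel) (SIGMA e:UNIV. {0..len G e})"

definition density_on_graph ::
  "('v, 'e::finite) quantum_graph \<Rightarrow> ('e \<Rightarrow> real \<Rightarrow> real) \<Rightarrow> ('v, 'e) graph_point measure" where
  "density_on_graph G \<rho> =
     distr (density (edges_lborel G) (\<lambda>(e, x). ennreal (\<rho> e x)))
       (borel_of_topology (graph_topology G)) (\<lambda>(e, x). edge_point G e x)"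

lemma edge_point_measurable:
  fixes G :: "('v, 'e::finite) quantum_graph"
  shows "(\<lambda>(e, x). edge_point G e x) \<in> edges_lborel G \<rightarrow>\<^sub>M borel_of_topology (graph_topology G)"
  unfolding borel_of_topology_def
proof (rule measurable_measure_of)
  show "{U. openin (graph_topology G) U} \<subseteq> Pow (topspace (graph_topology G))"
    using openin_subset by blast
  have sp: "space (edges_lborel G) = (SIGMA e:UNIV. {0..len G e})"
    by (auto simp: edges_lborel_def space_restrict_space space_pair_measure)
  show "(\<lambda>(e, x). edge_point G e x) \<in> space (edges_lborel G) \<rightarrow> topspace (graph_topology G)"
    using edge_point_in_graph_points by (fastforce simp: sp)
  fix U assume "U \<in> {U. openin (graph_topology G) U}"
  then have U: "openin (top_of_set {0..len G e}) {x \<in> {0..len G e}. edge_point G e x \<in> U}" for e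
    by (simp add: openin_graph_topology)
  have meas: "{x \<in> {0..len G e}. edge_point G e x \<in> U} \<in> sets borel" for e
  proof -
    obtain T where "open T" "{x \<in> {0..len G e}. edge_point G e x \<in> U} = T \<inter> {0..len G e}"
      using U[of e] by (auto simp: openin_open Int_commute)
    then show ?thesis by simp
  qed
  have "(\<lambda>(e, x). edge_point G e x) -` U \<inter> space (edges_lborel G) =
      (\<Union>e. {e} \<times> {x \<in> {0..len G e}. edge_point G e x \<in> U})"
    by (auto simp: sp)
  also have "\<dots> \<in> sets (count_space UNIV \<Otimes>\<^sub>M lborel)"
    using meas by (intro sets.finite_UN pair_measureI) auto
  finally have 1: "(\<lambda>(e, x). edge_point G e x) -` U \<inter> space (edges_lborel G)
      \<in> sets (count_space UNIV \<Otimes>\<^sub>M lborel)" .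
  have "(SIGMA e:UNIV. {0..len G e}) = (\<Union>e. {e} \<times> {0..len G e})"
    by auto
  also have "\<dots> \<in> sets (count_space UNIV \<Otimes>\<^sub>M lborel)"
    by (intro sets.finite_UN pair_measureI) auto
  finally show "(\<lambda>(e, x). edge_point G e x) -` U \<inter> space (edges_lborel G) \<in> sets (edges_lborel G)"
    using 1 by (simp add: edges_lborel_def sets_restrict_space_iff space_pair_measure
        space_restrict_space)
qed

definition weakly_converges ::
  "'a topology \<Rightarrow> (nat \<Rightarrow> 'a measure) \<Rightarrow> 'a measure \<Rightarrow> bool" where
  "weakly_converges X M N \<longleftrightarrow>
     (\<forall>\<phi>::'a \<Rightarrow> real. continuous_map X euclideanreal \<phi> \<and> bounded (\<phi> ` topspace X) \<longrightarrow>
        (\<lambda>n. LINT p|M n. \<phi> p) \<longlonglongrightarrow> (LINT p|N. \<phi> p))"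

definition total_length :: "('v, 'e::finite) quantum_graph \<Rightarrow> 'e set \<Rightarrow> real" where
  "total_length G K = (\<Sum>e\<in>K. len G e)"


section \<open>The torus\<close>

text \<open>\<open>\<real> / 2\<pi>\<int>\<close> with the quotient topology; the torus is \<open>angle ^ 'e\<close> with the product topology.\<close>

quotient_type angle = real / "\<lambda>x y. \<exists>n::int. x - y = 2 * pi * of_int n"
proof (rule equivpI)
  show "reflp (\<lambda>x y. \<exists>n::int. x - y = 2 * pi * of_int n)"
    by (rule reflpI, rule exI[of _ 0]) simp
  show "symp (\<lambda>x y. \<exists>n::int. x - y = 2 * pi * of_int n)"
  proof (rule sympI, elim exE)
    fix x y n assume "x - y = 2 * pi * of_int n"
    then show "\<exists>n::int. y - x = 2 * pi * of_int n" by (intro exI[of _ "- n"]) simp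
  qed
  show "transp (\<lambda>x y. \<exists>n::int. x - y = 2 * pi * of_int n)"
  proof (rule transpI, elim exE)
    fix x y z m n assume "x - y = 2 * pi * of_int m" "y - z = 2 * pi * of_int n"
    then show "\<exists>n::int. x - z = 2 * pi * of_int n"
      by (intro exI[of _ "m + n"]) (simp add: distrib_left)
  qed
qed

instantiation angle :: topological_space
begin

definition open_angle :: "angle set \<Rightarrow> bool" where
  "open_angle U \<longleftrightarrow> open (abs_angle -` U)"

instance
proof
  show "open (UNIV :: angle set)"
    by (simp add: open_angle_def)
  show "open (S \<inter> T)" if "open S" "open T" for S T :: "angle set"
    using that by (simp add: open_angle_def open_Int)
  show "open (\<Union>\<K>)" if "\<forall>S\<in>\<K>. open S" for \<K> :: "angle set set"
    using that by (simp add: open_angle_def vimage_Union open_UN)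
qed

end

lift_definition cis_angle :: "angle \<Rightarrow> complex" is cis
proof -
  fix x y assume "\<exists>n::int. x - y = 2 * pi * of_int n"
  then obtain n :: int where "x = y + 2 * pi * of_int n" by (auto simp: algebra_simps)
  then show "cis x = cis y" by (simp flip: cis_mult)
qed


section \<open>Bond scattering and the RAC condition\<close>

definition S_B :: "('v, 'e::finite) quantum_graph \<Rightarrow> complex ^ 'e bond ^ 'e bond" where
  "S_B G = (\<chi> b b'.
     (let v = origin G b; d = of_nat (vertex_degree G v) in
      if terminus G b' \<noteq> v then 0
      else if exterior G v then (case bcond G v of Dirichlet \<Rightarrow> - 1 | Neumann \<Rightarrow> 1)
      else if b' = rev_bond b then 2 / d - 1
      else 2 / d))"

definition D_B :: "angle ^ 'e::finite \<Rightarrow> complex ^ 'e bond ^ 'e bond" where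
  "D_B \<theta> = (\<chi> b b'. if b = b' then cis_angle (\<theta> $ fst b) else 0)"

definition U_B :: "('v, 'e::finite) quantum_graph \<Rightarrow> angle ^ 'e \<Rightarrow> complex ^ 'e bond ^ 'e bond" where
  "U_B G \<theta> = D_B \<theta> ** S_B G"

definition Z_B :: "('v, 'e::finite) quantum_graph \<Rightarrow> (angle ^ 'e) set" where
  "Z_B G = {\<theta>. det (mat 1 - U_B G \<theta>) = 0}"

definition edge_intensity :: "complex ^ 'e::finite bond \<Rightarrow> 'e \<Rightarrow> real" where
  "edge_intensity a e = (cmod (a $ (e, True)))\<^sup>2 + (cmod (a $ (e, False)))\<^sup>2"

text \<open>Simplicity is expressed by a one-dimensional eigenspace; since \<open>U_B G \<theta>\<close> is unitary,
  algebraic and geometric multiplicities agree.\<close>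

definition R_set :: "('v, 'e::finite) quantum_graph \<Rightarrow> 'e set \<Rightarrow> (angle ^ 'e) set" where
  "R_set G K = {\<theta> \<in> Z_B G. vec.dim {a. U_B G \<theta> *v a = a} = 1 \<and>
     (\<exists>a. a \<noteq> 0 \<and> U_B G \<theta> *v a = a \<and> (\<forall>e. edge_intensity a e > 0 \<longleftrightarrow> e \<in> K))}"

definition H_set :: "('v, 'e::finite) quantum_graph \<Rightarrow> (angle ^ 'e) set" where
  "H_set G = closure (range (\<lambda>k::real. \<chi> e. abs_angle (k * len G e)))"

definition RAC :: "('v, 'e::finite) quantum_graph \<Rightarrow> 'e set \<Rightarrow> bool" where
  "RAC G K \<longleftrightarrow> H_set G \<inter> R_set G K \<noteq> {}"

end

theory Submission
  imports Defs "HOL-Complex_Analysis.Great_Picard"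
begin

text \<open>If \<open>[t\<^sub>n \<ell>]\<close> tends to a point \<open>\<theta>\<close> of \<open>H\<^sub>\<ell> \<inter> \<R>\<^sub>K\<close>, where \<open>t\<^sub>n \<rightarrow> \<infinity>\<close> by recurrence of the linear
  flow, then the entire functions \<open>\<tau> \<mapsto> det (I - U_B (t\<^sub>n \<ell> + \<tau> \<ell>))\<close> converge locally uniformly to one
  that vanishes at \<open>0\<close>. By Hurwitz they have zeros \<open>\<tau>\<^sub>n \<rightarrow> 0\<close>, and these are real because \<open>U_B\<close> strictly
  contracts or expands off the real axis; so \<open>k\<^sub>n = t\<^sub>n + \<tau>\<^sub>n\<close> are frequencies of the graph.
  By simplicity of the eigenvalue \<open>1\<close> at \<open>\<theta>\<close>, the normalised amplitude vectors accumulate at an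
  eigenvector supported on \<open>K\<close>. Its intensity is the same on all edges of \<open>K\<close>, by conservation of
  energy through the vertices of \<open>K\<close>, and the interference terms of \<open>\<bar>u\<^sub>n\<bar>\<^sup>2\<close> average out by the
  Riemann-Lebesgue lemma.\<close>

section \<open>Bond scattering\<close>

lemma rev_bond_rev_bond [simp]: "rev_bond (rev_bond b) = b"
  by (simp add: rev_bond_def)

lemma fst_rev_bond [simp]: "fst (rev_bond b) = fst b"
  by (simp add: rev_bond_def)

lemma origin_rev_bond [simp]: "origin G (rev_bond b) = terminus G b"
  by (simp add: rev_bond_def origin_def terminus_def)

lemma terminus_rev_bond [simp]: "terminus G (rev_bond b) = origin G b"
  by (simp add: rev_bond_def origin_def terminus_def)

lemma rev_bond_eq_iff: "b' = rev_bond b \<longleftrightarrow> rev_bond b' = b"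
  using rev_bond_rev_bond by metis

lemma fst_eq_iff_rev_bond: "fst b = fst b' \<longleftrightarrow> b = b' \<or> b = rev_bond b'"
  by (auto simp: rev_bond_def prod_eq_iff)

lemma sum_rev_bond: "(\<Sum>b\<in>UNIV. f (rev_bond b)) = (\<Sum>b\<in>UNIV. f b)"
  by (rule sum.reindex_bij_witness[of _ rev_bond rev_bond]) auto

lemma origins_exterior:
  assumes "exterior G (origin G b)"
  shows "{b'. origin G b' = origin G b} = {b}"
proof -
  obtain c where "{b'. origin G b' = origin G b} = {c}"
    using assms by (auto simp: exterior_def vertex_degree_def card_1_singleton_iff)
  moreover from this have "b = c" by blast
  ultimately show ?thesis by simp
qed

lemma S_B_mult_exterior:
  assumes "exterior G (origin G b)"
  shows "(S_B G *v a) $ b =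
    (case bcond G (origin G b) of Dirichlet \<Rightarrow> - 1 | Neumann \<Rightarrow> 1) * a $ rev_bond b"
proof -
  let ?c = "case bcond G (origin G b) of Dirichlet \<Rightarrow> - 1 | Neumann \<Rightarrow> (1::complex)"
  have "terminus G b' = origin G b \<longleftrightarrow> b' = rev_bond b" for b'
    using origins_exterior[OF assms] rev_bond_eq_iff[of b' b] by (force simp flip: origin_rev_bond)
  then have S: "S_B G $ b $ b' = (if b' = rev_bond b then ?c else 0)" for b'
    using assms by (simp add: S_B_def Let_def)
  show ?thesis
    by (simp add: matrix_vector_mult_def S if_distrib[of "\<lambda>x. x * _"] cong: if_cong)
qed

text \<open>The row of \<open>S_B\<close> at \<open>b\<close> is \<open>2 / d\<close> on every bond
  ending at the vertex, with 1 subtracted at the reverse of \<open>b\<close>. Indexing arriving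
  amplitudes by outgoing bonds through \<open>rev_bond\<close> makes this twice the mean minus the
  identity.\<close>

lemma S_B_mult_interior:
  assumes "\<not> exterior G (origin G b)"
  shows "(S_B G *v a) $ b = 2 / of_nat (vertex_degree G (origin G b)) *
    (\<Sum>b' | origin G b' = origin G b. a $ rev_bond b') - a $ rev_bond b"
proof -
  let ?v = "origin G b" and ?d = "of_nat (vertex_degree G (origin G b)) :: complex"
  have S: "S_B G $ b $ b' * a $ b' =
      (if terminus G b' = ?v then 2 / ?d * a $ b' else 0) - (if b' = rev_bond b then a $ b' else 0)"
    for b'
    using assms by (auto simp: S_B_def Let_def algebra_simps)
  have "(\<Sum>b' | terminus G b' = ?v. 2 / ?d * a $ b') =
      (\<Sum>b' | origin G b' = ?v. 2 / ?d * a $ rev_bond b')"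
    by (rule sum.reindex_bij_witness[of _ rev_bond rev_bond]) auto
  then show ?thesis
    by (simp add: matrix_vector_mult_def S sum_subtractf sum.If_cases sum_distrib_left)
qed

text \<open>As \<open>m\<close> is twice the mean, subtracting from \<open>m\<close> is the
  reflection that fixes the constant vectors: the cross term of the expanded square cancels the
  contribution of \<open>m\<close> itself.\<close>

lemma householder_norm:
  fixes c :: "'a \<Rightarrow> complex"
  assumes "finite B"
  defines "m \<equiv> 2 / of_nat (card B) * sum c B"
  shows "(\<Sum>b\<in>B. (cmod (m - c b))\<^sup>2) = (\<Sum>b\<in>B. (cmod (c b))\<^sup>2)"
proof (cases "card B = 0")
  case True
  then show ?thesis using assms by simp
next
  case False
  then have s: "sum c B = of_nat (card B) / 2 * m" by (simp add: m_def)
  have cm: "(cmod (x - y))\<^sup>2 = (cmod x)\<^sup>2 - 2 * Re (cnj x * y) + (cmod y)\<^sup>2" for x y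
    unfolding cmod_power2 by (simp add: power2_eq_square algebra_simps)
  have "(\<Sum>b\<in>B. (cmod (m - c b))\<^sup>2) =
      (\<Sum>b\<in>B. (cmod m)\<^sup>2 - 2 * Re (cnj m * c b) + (cmod (c b))\<^sup>2)"
    by (simp add: cm)
  also have "\<dots> = card B * (cmod m)\<^sup>2 - 2 * Re (cnj m * sum c B) + (\<Sum>b\<in>B. (cmod (c b))\<^sup>2)"
    by (simp add: sum.distrib sum_subtractf sum_distrib_left)
  also have "2 * Re (cnj m * sum c B) = card B * (cmod m)\<^sup>2"
    unfolding s cmod_power2 by (simp add: power2_eq_square algebra_simps)
  finally show ?thesis by simp
qed

text \<open>Unitarity of \<open>S_B\<close>. With bonds grouped by origin, arriving amplitudes are
  reflected at an interior vertex and multiplied by a sign at an exterior one; over the whole graph,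
  reversal only permutes the bonds.\<close>

lemma S_B_norm: "(\<Sum>b\<in>UNIV. (cmod ((S_B G *v a) $ b))\<^sup>2) = (\<Sum>b\<in>UNIV. (cmod (a $ b))\<^sup>2)"
proof -
  have vertex: "(\<Sum>b | origin G b = v. (cmod ((S_B G *v a) $ b))\<^sup>2) =
      (\<Sum>b | origin G b = v. (cmod (a $ rev_bond b))\<^sup>2)" for v
  proof (cases "exterior G v")
    case True
    have "cmod ((S_B G *v a) $ b) = cmod (a $ rev_bond b)" if "origin G b = v" for b
      using S_B_mult_exterior[of G b a] that True
      by (cases "bcond G v") (simp_all add: norm_mult)
    then show ?thesis by simp
  next
    case False
    let ?B = "{b. origin G b = v}"
    have "(S_B G *v a) $ b =
        2 / of_nat (card ?B) * (\<Sum>b\<in>?B. a $ rev_bond b) - a $ rev_bond b" if "b \<in> ?B" for b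
      using S_B_mult_interior[of G b a] that False by (simp add: vertex_degree_def)
    then show ?thesis
      using householder_norm[of ?B "\<lambda>b. a $ rev_bond b"] by simp
  qed
  have grp: "(\<Sum>v\<in>range (origin G). \<Sum>b | origin G b = v. f b) = (\<Sum>b\<in>UNIV. f b)"
    for f :: "_ \<Rightarrow> real"
    using sum.group[of UNIV "range (origin G)" "origin G" f] by simp
  show ?thesis
    using grp[of "\<lambda>b. (cmod ((S_B G *v a) $ b))\<^sup>2"] grp[of "\<lambda>b. (cmod (a $ rev_bond b))\<^sup>2"]
      sum_rev_bond[of "\<lambda>b. (cmod (a $ b))\<^sup>2"]
    by (simp add: vertex)
qed

text \<open>The matrix \<open>D(\<theta>) S_B\<close>, with the diagonal entries \<open>w = e\<^sup>i\<^sup>\<theta>\<close> allowed to be arbitrary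
  complex numbers.\<close>

definition bond_evolution ::
  "('v, 'e::finite) quantum_graph \<Rightarrow> complex ^ 'e \<Rightarrow> complex ^ 'e bond ^ 'e bond" where
  "bond_evolution G w = (\<chi> b b'. w $ fst b * S_B G $ b $ b')"

lemma bond_evolution_mult: "(bond_evolution G w *v a) $ b = w $ fst b * (S_B G *v a) $ b"
  by (simp add: bond_evolution_def matrix_vector_mult_def sum_distrib_left mult.assoc)

lemma U_B_eq_bond_evolution: "U_B G \<theta> = bond_evolution G (\<chi> e. cis_angle (\<theta> $ e))"
  by (simp add: U_B_def D_B_def bond_evolution_def matrix_matrix_mult_def vec_eq_iff
      if_distrib[of "\<lambda>x. x * _"] cong: if_cong)

text \<open>The energy \<open>\<bar>u'\<bar>\<^sup>2 + k\<^sup>2 \<bar>u\<bar>\<^sup>2\<close> of a wave is constant along each edge. It is also continuous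
  across an interior vertex at which the wave is non-zero only on two bonds: there the values agree
  and the outgoing derivatives are opposite.\<close>

lemma edge_intensity_through_vertex:
  assumes eig: "bond_evolution G w *v a = a" and w: "\<And>e. cmod (w $ e) = 1"
    and v: "origin G b1 = origin G b2" and ne: "b1 \<noteq> b2"
    and zero: "\<And>b. origin G b = origin G b1 \<Longrightarrow> b \<noteq> b1 \<Longrightarrow> b \<noteq> b2 \<Longrightarrow> edge_intensity a (fst b) = 0"
  shows "edge_intensity a (fst b1) = edge_intensity a (fst b2)"
proof -
  let ?v = "origin G b1"
  \<comment> \<open>\<open>p\<close> holds the amplitudes leaving the vertex, \<open>q\<close> those
    arriving there. The wave has value \<open>p b + q b\<close> and outgoing derivative proportional
    to \<open>p b - q b\<close>.\<close>
  define p where "p b = (S_B G *v a) $ b" for b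
  define q where "q b = a $ rev_bond b" for b
  have a: "a $ b = w $ fst b * p b" for b
    using bond_evolution_mult[of G w a b] by (simp add: eig p_def)
  have int: "edge_intensity a (fst b) = (cmod (p b))\<^sup>2 + (cmod (q b))\<^sup>2" for b
  proof -
    have "cmod (p b) = cmod (a $ b)" by (simp add: a norm_mult w)
    then show ?thesis
      by (cases b; cases "snd b") (simp_all add: edge_intensity_def q_def rev_bond_def)
  qed
  have "\<not> exterior G ?v"
    using origins_exterior[of G b1] v ne by auto
  let ?B = "{b. origin G b = ?v}"
  have p: "p b = 2 / of_nat (card ?B) * sum q ?B - q b" if "b \<in> ?B" for b
    using S_B_mult_interior[of G b a] that \<open>\<not> exterior G ?v\<close>
    by (simp add: vertex_degree_def p_def q_def)
  have "b1 \<in> ?B" by simp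
  then have "card ?B \<noteq> 0" by (metis card_0_eq empty_iff finite)
  \<comment> \<open>Kirchhoff's condition: the \<open>card ?B\<close> copies of twice the mean add
    up to twice \<open>sum q ?B\<close>.\<close>
  moreover have "(\<Sum>b\<in>?B. p b - q b) =
      (\<Sum>b\<in>?B. 2 / of_nat (card ?B) * sum q ?B - 2 * q b)"
    by (rule sum.cong) (simp_all add: p)
  moreover have "\<dots> = of_nat (card ?B) * (2 / of_nat (card ?B) * sum q ?B) - 2 * sum q ?B"
    unfolding sum_subtractf sum_distrib_left[symmetric] by simp
  ultimately have "(\<Sum>b\<in>?B. p b - q b) = 0"
    by simp
  moreover have "p b - q b = 0" if "b \<in> ?B - {b1, b2}" for b
  proof -
    have "(cmod (p b))\<^sup>2 + (cmod (q b))\<^sup>2 = 0" using zero[of b] that by (simp add: int)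
    then show ?thesis by (simp add: sum_power2_eq_zero_iff)
  qed
  then have "(\<Sum>b\<in>?B. p b - q b) = (\<Sum>b\<in>{b1, b2}. p b - q b)"
    using v by (intro sum.mono_neutral_right) auto
  ultimately have minus: "p b1 - q b1 = - (p b2 - q b2)"
    using ne by (simp add: algebra_simps add_eq_0_iff2)
  have plus: "p b1 + q b1 = p b2 + q b2"
    using p[of b1] p[of b2] v by simp
  \<comment> \<open>By the parallelogram law, equal sums and opposite differences give equal
    intensities.\<close>
  have "2 * ((cmod x)\<^sup>2 + (cmod y)\<^sup>2) = (cmod (x - y))\<^sup>2 + (cmod (x + y))\<^sup>2" for x y
    unfolding cmod_power2 by (simp add: power2_eq_square algebra_simps)
  moreover have "cmod (p b1 - q b1) = cmod (p b2 - q b2)"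
    unfolding minus by (rule norm_minus_cancel)
  ultimately have "2 * edge_intensity a (fst b1) = 2 * edge_intensity a (fst b2)"
    unfolding int by (simp only: plus)
  then show ?thesis by simp
qed

text \<open>Induction along the walk: where two consecutive bonds meet, distinct origins leave no
  further bond of the support, so the intensity passes through the vertex. The hypothesis
  \<open>last\<close> forbids the end to meet any origin but the first, which admits cycles as well
  as paths.\<close>

lemma edge_intensity_const_along_walk:
  assumes eig: "bond_evolution G w *v a = a" and w: "\<And>e. cmod (w $ e) = 1"
    and walk: "bond_walk G bs" and dist: "distinct (map (origin G) bs)"
    and last: "terminus G (last bs) \<notin> origin G ` set (tl bs)"
    and supp: "\<And>e. e \<notin> fst ` set bs \<Longrightarrow> edge_intensity a e = 0"
    and i: "i < length bs"
  shows "edge_intensity a (fst (bs ! i)) = edge_intensity a (fst (bs ! 0))"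
  using i
proof (induction i)
  case 0
  show ?case by simp
next
  case (Suc i)
  let ?b1 = "rev_bond (bs ! i)" and ?b2 = "bs ! Suc i"
  have orig_inj: "j = j'" if "origin G (bs ! j) = origin G (bs ! j')" "j < length bs" "j' < length bs"
    for j j'
    using nth_eq_iff_index_eq[OF dist, of j j'] that by simp
  have v: "origin G ?b1 = origin G ?b2"
    using walk Suc.prems by (simp add: bond_walk_def)
  have "edge_intensity a (fst ?b1) = edge_intensity a (fst ?b2)"
  proof (cases "?b1 = ?b2")
    case False
    have "edge_intensity a (fst b) = 0" if b: "origin G b = origin G ?b1" "b \<noteq> ?b1" "b \<noteq> ?b2" for b
    proof (rule supp, rule notI)
      assume "fst b \<in> fst ` set bs"
      then obtain j where j: "j < length bs" "fst b = fst (bs ! j)"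
        by (auto simp: in_set_conv_nth)
      from j(2) consider "b = bs ! j" | "b = rev_bond (bs ! j)"
        unfolding fst_eq_iff_rev_bond by blast
      then show False
      proof cases
        case 1
        then have "j = Suc i" using orig_inj[of j "Suc i"] b(1) v j(1) Suc.prems by metis
        with 1 b(3) show False by simp
      next
        case 2
        then have t: "terminus G (bs ! j) = origin G ?b2" using b(1) v by simp
        show False
        proof (cases "Suc j < length bs")
          case True
          then have "terminus G (bs ! j) = origin G (bs ! Suc j)"
            using walk by (simp add: bond_walk_def)
          then have "origin G (bs ! Suc j) = origin G ?b2" using t by (rule trans[OF sym])
          then have "Suc j = Suc i" using orig_inj True Suc.prems by blast
          then have "j = i" by simp
          with 2 b(2) show False by simp
        next
          case False
          then have "j = length bs - 1" using j(1) by simp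
          moreover have "bs \<noteq> []" using j(1) by auto
          ultimately have "last bs = bs ! j" by (simp add: last_conv_nth)
          moreover have "tl bs ! i \<in> set (tl bs)"
            using Suc.prems by (intro nth_mem) simp
          moreover have "tl bs ! i = ?b2"
            using Suc.prems by (simp add: nth_tl)
          ultimately show False using last t by (metis imageI)
        qed
      qed
    qed
    then show ?thesis
      using edge_intensity_through_vertex[OF eig w v False] by blast
  qed simp
  then show ?case using Suc by simp
qed

text \<open>The end of a cycle is the origin of its first bond, which distinctness keeps out of the
  tail; the end of a path is no origin at all. So the walk argument covers both kinds.\<close>

lemma edge_intensity_const_on_primitive_subgraph:
  assumes "primitive_subgraph G K"
    and eig: "bond_evolution G w *v a = a" and w: "\<And>e. cmod (w $ e) = 1"
    and supp: "\<And>e. e \<notin> K \<Longrightarrow> edge_intensity a e = 0"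
  obtains c where "\<And>e. e \<in> K \<Longrightarrow> edge_intensity a e = c" "K \<noteq> {}"
proof -
  obtain bs where bs: "bond_walk G bs" "distinct (map (origin G) bs)" "K = fst ` set bs"
    and last: "terminus G (last bs) = origin G (hd bs) \<or> terminus G (last bs) \<notin> origin G ` set bs"
    using assms(1) unfolding primitive_subgraph_def simple_cycle_def simple_exterior_path_def
    by auto
  from bs(1) have ne: "bs \<noteq> []" by (simp add: bond_walk_def)
  have "origin G (hd bs) \<notin> origin G ` set (tl bs)"
    using ne bs(2) by (metis distinct.simps(2) image_set list.collapse list.map(2))
  moreover have "set (tl bs) \<subseteq> set bs"
    by (cases bs) auto
  ultimately have tl: "terminus G (last bs) \<notin> origin G ` set (tl bs)"
    using last by auto
  have supp': "edge_intensity a e = 0" if "e \<notin> fst ` set bs" for e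
    using supp that bs(3) by simp
  note const = edge_intensity_const_along_walk[OF eig w bs(1,2) tl supp']
  show ?thesis
  proof (rule that)
    show "edge_intensity a e = edge_intensity a (fst (bs ! 0))" if "e \<in> K" for e
      using that const unfolding bs(3) by (metis imageE in_set_conv_nth)
    show "K \<noteq> {}" using ne by (simp add: bs(3))
  qed
qed


section \<open>Zeros of the secular function\<close>

lemma det_one_minus_eq_0_iff:
  fixes A :: "complex ^ 'n ^ 'n"
  shows "det (mat 1 - A) = 0 \<longleftrightarrow> (\<exists>a. a \<noteq> 0 \<and> A *v a = a)"
proof -
  have "det (mat 1 - A) = 0 \<longleftrightarrow> (\<exists>a. (mat 1 - A) *v a = 0 \<and> a \<noteq> 0)"
    using invertible_det_nz[of "mat 1 - A"] matrix_left_invertible_ker[of "mat 1 - A"]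
    by (auto simp: invertible_left_inverse)
  then show ?thesis
    by (auto simp: matrix_vector_mult_diff_rdistrib)
qed

definition phase_shift :: "('v, 'e::finite) quantum_graph \<Rightarrow> complex ^ 'e \<Rightarrow> complex \<Rightarrow> complex ^ 'e" where
  "phase_shift G w \<tau> = (\<chi> e. w $ e * exp (\<i> * \<tau> * of_real (len G e)))"

definition secular :: "('v, 'e::finite) quantum_graph \<Rightarrow> complex ^ 'e \<Rightarrow> complex \<Rightarrow> complex" where
  "secular G w \<tau> = det (mat 1 - bond_evolution G (phase_shift G w \<tau>))"

lemma phase_shift_0 [simp]: "phase_shift G w 0 = w"
  by (simp add: phase_shift_def vec_eq_iff)

text \<open>Off the real axis the evolution strictly contracts or strictly expands every vector, by
  unitarity of \<open>S_B\<close>.\<close>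

lemma secular_zero_real:
  assumes G: "metric_graph G" and w: "\<And>e. cmod (w $ e) = 1" and zero: "secular G w \<tau> = 0"
  shows "Im \<tau> = 0"
proof (rule ccontr)
  assume Im: "Im \<tau> \<noteq> 0"
  obtain a where "a \<noteq> 0" and eig: "bond_evolution G (phase_shift G w \<tau>) *v a = a"
    using zero by (auto simp: secular_def det_one_minus_eq_0_iff)
  define r where "r b = exp (- Im \<tau> * len G (fst b))" for b :: "'b bond"
  define s where "s b = (cmod ((S_B G *v a) $ b))\<^sup>2" for b
  have a: "a $ b = phase_shift G w \<tau> $ fst b * (S_B G *v a) $ b" for b
    using bond_evolution_mult[of G "phase_shift G w \<tau>" a b] by (simp add: eig)
  have "cmod (a $ b) = r b * cmod ((S_B G *v a) $ b)" for b
    by (subst a) (simp add: phase_shift_def norm_mult w r_def)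
  then have "(\<Sum>b\<in>UNIV. (r b)\<^sup>2 * s b) = (\<Sum>b\<in>UNIV. s b)"
    using S_B_norm[of G a] by (simp add: s_def power_mult_distrib)
  then have "(\<Sum>b\<in>UNIV. (1 - (r b)\<^sup>2) * s b) = 0"
    by (simp add: sum_subtractf left_diff_distrib)
  \<comment> \<open>The sign factor treats contraction and expansion together: it makes all
    coefficients of the \<open>s b\<close> positive, so a vanishing sum forces every
    \<open>s b\<close> to vanish.\<close>
  then have 0: "(\<Sum>b\<in>UNIV. sgn (Im \<tau>) * (1 - (r b)\<^sup>2) * s b) = 0"
    by (simp only: mult.assoc sum_distrib_left[symmetric] mult_zero_right)
  have pos: "sgn (Im \<tau>) * (1 - (r b)\<^sup>2) > 0" for b
  proof -
    have "len G (fst b) > 0" using G by (simp add: metric_graph_def)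
    then show ?thesis
      using Im by (cases "Im \<tau> > 0")
        (auto simp: r_def power_less_one_iff one_less_power mult_neg_pos)
  qed
  have "sgn (Im \<tau>) * (1 - (r b)\<^sup>2) * s b \<ge> 0" for b
    by (rule mult_nonneg_nonneg[OF less_imp_le[OF pos]]) (simp add: s_def)
  then have "\<forall>b\<in>UNIV. sgn (Im \<tau>) * (1 - (r b)\<^sup>2) * s b = 0"
    using 0 by (subst (asm) sum_nonneg_eq_0_iff) auto
  then have "s b = 0" for b
    using pos[of b] by (metis UNIV_I less_irrefl mult_eq_0_iff)
  then have "a $ b = 0" for b
    using a[of b] by (simp add: s_def)
  then show False
    using \<open>a \<noteq> 0\<close> by (simp add: vec_eq_iff)
qed

text \<open>The Leibniz expansion exhibits a finite combination of exponentials, from which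
  holomorphy in \<tau> and joint continuity are read off.\<close>

lemma secular_eq_sum:
  "secular G w \<tau> = (\<Sum>p | p permutes UNIV. of_int (sign p) *
     (\<Prod>b\<in>UNIV. mat 1 $ b $ p b -
        w $ fst b * exp (\<i> * \<tau> * of_real (len G (fst b))) * S_B G $ b $ p b))"
  by (simp add: secular_def det_def bond_evolution_def phase_shift_def)

lemma secular_holomorphic: "secular G w holomorphic_on A"
  unfolding secular_eq_sum[abs_def] by (intro holomorphic_intros)

lemma secular_continuous: "continuous_on A (\<lambda>(w, \<tau>). secular G w \<tau>)"
  unfolding secular_eq_sum split_beta by (intro continuous_intros)

text \<open>Otherwise phases \<open>z n\<close> tending to \<open>w\<close> would have secular
  functions without zeros in the disc of radius \<epsilon>. These converge locally uniformly, so by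
  Hurwitz the nonconstant limit could not vanish at 0.\<close>

lemma secular_zero_nearby:
  assumes G: "metric_graph G" and w: "\<And>e. cmod (w $ e) = 1"
    and zero: "secular G w 0 = 0" and \<epsilon>: "\<epsilon> > 0"
  shows "\<exists>\<delta>>0. \<forall>z. (\<forall>e. cmod (z $ e) = 1) \<and> dist z w < \<delta> \<longrightarrow>
    (\<exists>\<tau>::real. \<bar>\<tau>\<bar> < \<epsilon> \<and> secular G z (of_real \<tau>) = 0)"
proof (rule ccontr)
  let ?P = "\<lambda>z. (\<forall>e. cmod (z $ e) = 1) \<and> \<not> (\<exists>\<tau>::real. \<bar>\<tau>\<bar> < \<epsilon> \<and> secular G z (of_real \<tau>) = 0)"
  assume "\<not> ?thesis"
  then have "\<exists>z. dist z w < inverse (real (Suc n)) \<and> ?P z" for n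
    by (metis inverse_positive_iff_positive of_nat_0_less_iff zero_less_Suc)
  then obtain z where z: "dist (z n) w < inverse (real (Suc n))" "?P (z n)" for n
    by metis
  have lim: "z \<longlonglongrightarrow> w"
    using z(1)
    by (intro metric_tendsto_imp_tendsto[OF LIMSEQ_inverse_real_of_nat])
       (auto intro!: always_eventually less_imp_le)
  \<comment> \<open>All zeros are real by \<open>secular_zero_real\<close>, so the absence of small
    real zeros clears the whole disc.\<close>
  have nz: "secular G (z n) \<tau> \<noteq> 0" if "\<tau> \<in> ball 0 \<epsilon>" for n \<tau>
  proof
    assume 0: "secular G (z n) \<tau> = 0"
    then have "Im \<tau> = 0" using secular_zero_real[OF G] z(2) by blast
    then have \<tau>: "\<tau> = of_real (Re \<tau>)" by (simp add: complex_eq_iff)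
    then have "\<bar>Re \<tau>\<bar> < \<epsilon>" using that by (metis dist_0_norm mem_ball norm_of_real)
    with z(2) 0 \<tau> show False by metis
  qed
  have unif: "uniform_limit C (\<lambda>n. secular G (z n)) (secular G w) sequentially" if C: "compact C" for C
    unfolding uniform_limit_iff
  proof (intro allI impI)
    fix e :: real assume "e > 0"
    \<comment> \<open>Joint continuity and compactness of \<open>C\<close> give one neighbourhood of
      \<open>w\<close> that serves all points of \<open>C\<close>.\<close>
    then obtain X where X: "w \<in> X" "open X"
      and le: "\<forall>x\<in>X \<inter> UNIV. \<forall>t\<in>C. dist ((\<lambda>(w, \<tau>). secular G w \<tau>) (x, t))
        ((\<lambda>(w, \<tau>). secular G w \<tau>) (w, t)) \<le> e / 2"
      using continuous_on_prod_compactE[OF secular_continuous C, of w UNIV "e / 2"]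
      by (metis UNIV_I half_gt_zero)
    have "eventually (\<lambda>n. z n \<in> X) sequentially"
      using lim X topological_tendstoD by blast
    then show "\<forall>\<^sub>F n in sequentially. \<forall>x\<in>C. dist (secular G (z n) x) (secular G w x) < e"
      by eventually_elim (use le \<open>e > 0\<close> in fastforce)
  qed
  \<comment> \<open>A constant function would vanish identically, in particular at the nonreal point
    \<open>\<i> * \<epsilon> / 2\<close>.\<close>
  have nonconst: "\<not> secular G w constant_on ball 0 \<epsilon>"
  proof
    let ?\<tau> = "\<i> * of_real (\<epsilon> / 2)"
    assume "secular G w constant_on ball 0 \<epsilon>"
    moreover have "?\<tau> \<in> ball 0 \<epsilon>" "0 \<in> ball (0::complex) \<epsilon>"
      using \<epsilon> by (simp_all add: norm_mult)
    ultimately have "secular G w ?\<tau> = 0"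
      using zero unfolding constant_on_def by metis
    then have "Im ?\<tau> = 0" by (rule secular_zero_real[OF G w])
    with \<epsilon> show False by simp
  qed
  have "secular G w 0 \<noteq> 0"
    by (rule Hurwitz_no_zeros[OF open_ball connected_ball secular_holomorphic secular_holomorphic
          unif nonconst nz]) (use \<epsilon> in auto)
  with zero show False by simp
qed


section \<open>Recurrence of the linear flow\<close>

text \<open>A time \<open>s\<close> with \<open>W s\<close> near \<open>w\<close> need not be large.
  By compactness two multiples \<open>n < m\<close> of a large step have \<open>W m\<close> near
  \<open>W n\<close>; rotation invariance of the metric then puts \<open>W (m - n + s)\<close> near
  \<open>W s\<close>.\<close>

lemma cis_flow_recurrent:
  fixes \<omega> :: "'e::finite \<Rightarrow> real"
  defines "W \<equiv> \<lambda>t::real. (\<chi> e. cis (t * \<omega> e)) :: complex ^ 'e"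
  assumes w: "w \<in> closure (range W)" and \<epsilon>: "\<epsilon> > 0"
  shows "\<exists>t\<ge>N. dist (W t) w < \<epsilon>"
proof -
  obtain s where s: "dist (W s) w < \<epsilon> / 2"
    using w \<epsilon> closure_approachable[of w "range W"] by (auto dest: spec[of _ "\<epsilon> / 2"])
  \<comment> \<open>Any two distinct multiples of \<open>M\<close> differ by at least
    \<open>N - s\<close>, which makes the final time at least \<open>N\<close>.\<close>
  obtain M :: nat where M: "real M \<ge> max 0 (N - s)"
    using real_arch_simple by blast
  define f where "f n = W (real (n * M))" for n
  have "f n \<in> cball 0 (L2_set (\<lambda>_. 1) (UNIV :: 'e set))" for n
    by (simp add: f_def W_def norm_vec_def)
  then obtain l r where r: "strict_mono r" "(f \<circ> r) \<longlonglongrightarrow> l"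
    using compact_cball[of 0 "L2_set (\<lambda>_. 1) (UNIV :: 'e set)"]
    unfolding compact_eq_seq_compact_metric seq_compact_def by metis
  then have "Cauchy (f \<circ> r)" by (intro convergent_Cauchy) (auto simp: convergent_def)
  then obtain i where i: "dist (f (r (Suc i))) (f (r i)) < \<epsilon> / 2"
    using \<epsilon> unfolding Cauchy_def by (metis comp_apply half_gt_zero le_Suc_eq le_refl)
  define m n where "m = real (r (Suc i) * M)" and "n = real (r i * M)"
  \<comment> \<open>The common factor has modulus one, so the distance in each coordinate is
    unchanged.\<close>
  have "cis ((m - n + s) * \<omega> e) - cis (s * \<omega> e) =
      cis ((s - n) * \<omega> e) * (cis (m * \<omega> e) - cis (n * \<omega> e))" for e
    by (simp add: right_diff_distrib cis_mult algebra_simps)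
  then have "dist (cis ((m - n + s) * \<omega> e)) (cis (s * \<omega> e)) =
      dist (cis (m * \<omega> e)) (cis (n * \<omega> e))" for e
    by (simp add: dist_norm norm_mult)
  then have "dist (W (m - n + s)) (W s) = dist (W m) (W n)"
    by (simp add: W_def dist_vec_def)
  then have "dist (W (m - n + s)) w < \<epsilon>"
    using i s dist_triangle[of "W (m - n + s)" w "W s"]
    unfolding f_def m_def n_def by linarith
  moreover have "r i + 1 \<le> r (Suc i)"
    using r(1) by (simp add: strict_mono_def Suc_leI)
  then have "real ((r i + 1) * M) \<le> m"
    unfolding m_def by (intro of_nat_mono mult_right_mono) auto
  then have "m - n + s \<ge> N"
    using M by (simp add: n_def algebra_simps)
  ultimately show ?thesis by blast
qed

section \<open>From the torus of angles to unimodular complex vectors\<close>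

lemma continuous_on_cis_angle: "continuous_on UNIV cis_angle"
  unfolding continuous_on_open_vimage[OF open_UNIV]
proof (intro allI impI)
  fix B :: "complex set" assume "open B"
  have "abs_angle -` (cis_angle -` B) = cis -` B"
    by (auto simp: cis_angle.abs_eq)
  moreover have "open (cis -` B)"
    using \<open>open B\<close> by (rule open_vimage) (intro continuous_intros)
  ultimately show "open (cis_angle -` B \<inter> UNIV)"
    by (simp add: open_angle_def)
qed

text \<open>A continuous map sends a closure into the closure of the image; this moves the orbit
  closure into a metric space, where recurrence was proved.\<close>

lemma H_set_cis:
  fixes G :: "('v, 'e::finite) quantum_graph"
  assumes "\<theta> \<in> H_set G"
  shows "(\<chi> e. cis_angle (\<theta> $ e)) \<in> closure (range (\<lambda>t. \<chi> e. cis (t * len G e)))"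
proof -
  let ?c = "\<lambda>\<theta> :: angle ^ 'e. \<chi> e. cis_angle (\<theta> $ e)"
  have nth: "continuous_on UNIV (\<lambda>\<theta> :: angle ^ 'e. \<theta> $ e)" for e
    by (simp add: continuous_on_def tendsto_vec_nth)
  have "continuous_on UNIV ?c"
    using continuous_on_compose2[OF continuous_on_cis_angle nth]
    by (intro continuous_on_vec_lambda) auto
  then have "?c ` H_set G \<subseteq> closure (range (\<lambda>t. \<chi> e. cis (t * len G e)))"
    unfolding H_set_def
    by (intro image_closure_subset)
       (auto intro: continuous_on_subset closure_subset[THEN subsetD] simp: cis_angle.abs_eq)
  with assms show ?thesis by blast
qed

lemma norm_cis_angle: "cmod (cis_angle x) = 1"
  by transfer simp

lemma matrix_vector_mult_scaleR_complex:
  fixes A :: "complex ^ 'n ^ 'm"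
  shows "A *v (c *\<^sub>R x) = c *\<^sub>R (A *v x)"
  by (simp add: matrix_vector_mult_def vec_eq_iff scaleR_right.sum)

section \<open>Frequencies and convergent amplitude vectors\<close>

lemma bond_evolution_tendsto:
  assumes "w \<longlonglongrightarrow> w'" "a \<longlonglongrightarrow> a'"
  shows "(\<lambda>n. bond_evolution G (w n) *v a n) \<longlonglongrightarrow> bond_evolution G w' *v a'"
  by (rule vec_tendstoI)
     (unfold bond_evolution_mult, unfold matrix_vector_mult_def vec_lambda_beta,
      intro tendsto_intros tendsto_vec_nth assms)

text \<open>Recurrence supplies late times \<open>t n\<close> with phases near \<theta>, and a small
  real correction \<open>\<tau> n\<close> makes \<open>t n + \<tau> n\<close> an exact zero. Unit
  eigenvectors converge along a subsequence by compactness of the sphere, and the eigenvalue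
  equation passes to the limit.\<close>

lemma eigenvector_sequence:
  assumes G: "metric_graph G" and H: "\<theta> \<in> H_set G" and Z: "\<theta> \<in> Z_B G"
  obtains k :: "nat \<Rightarrow> real" and a a' where
    "filterlim k at_top sequentially"
    "\<And>n. bond_evolution G (\<chi> e. cis (k n * len G e)) *v a n = a n"
    "a \<longlonglongrightarrow> a'" "norm a' = 1" "U_B G \<theta> *v a' = a'"
proof -
  define W where "W t = (\<chi> e. cis (t * len G e))" for t
  define w where "w = (\<chi> e. cis_angle (\<theta> $ e))"
  have w: "cmod (w $ e) = 1" for e by (simp add: w_def norm_cis_angle)
  have zero: "secular G w 0 = 0"
    using Z by (simp add: Z_B_def secular_def w_def U_B_eq_bond_evolution)
  have shift: "phase_shift G (W t) (of_real \<tau>) = W (t + \<tau>)" for t \<tau>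
    by (simp add: phase_shift_def W_def vec_eq_iff distrib_right flip: cis_mult)
       (simp add: cis_conv_exp mult.assoc)
  have "\<exists>t \<tau>. t \<ge> real n \<and> dist (W t) w < inverse (real (Suc n)) \<and>
      \<bar>\<tau>\<bar> < inverse (real (Suc n)) \<and> secular G (W t) (of_real \<tau>) = 0" for n
  proof -
    let ?\<epsilon> = "inverse (real (Suc n))"
    obtain \<delta> where \<delta>: "\<delta> > 0" "\<And>z. (\<forall>e. cmod (z $ e) = 1) \<Longrightarrow> dist z w < \<delta> \<Longrightarrow>
        \<exists>\<tau>::real. \<bar>\<tau>\<bar> < ?\<epsilon> \<and> secular G z (of_real \<tau>) = 0"
      using secular_zero_nearby[OF G w zero, of ?\<epsilon>] by auto
    \<comment> \<open>The bound \<delta> guarantees the nearby zero; \<open>?\<epsilon>\<close>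
      makes the phases converge.\<close>
    have "\<exists>t\<ge>real n. dist (\<chi> e. cis (t * len G e)) w < min \<delta> ?\<epsilon>"
      by (rule cis_flow_recurrent) (use H_set_cis[OF H] \<delta>(1) in \<open>simp_all add: w_def\<close>)
    then obtain t where t: "t \<ge> real n" "dist (W t) w < min \<delta> ?\<epsilon>"
      by (auto simp: W_def)
    then show ?thesis
      using \<delta>(2)[of "W t"] by (auto simp: W_def)
  qed
  then obtain t \<tau> where t: "\<And>n. t n \<ge> real n" "\<And>n. dist (W (t n)) w < inverse (real (Suc n))"
    and \<tau>: "\<And>n. \<bar>\<tau> n\<bar> < inverse (real (Suc n))" "\<And>n. secular G (W (t n)) (of_real (\<tau> n)) = 0"
    by metis
  define k where "k n = t n + \<tau> n" for n
  have "\<exists>a. a \<noteq> 0 \<and> bond_evolution G (W (k n)) *v a = a" for n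
    using \<tau>(2)[of n] by (simp add: secular_def det_one_minus_eq_0_iff shift k_def)
  then obtain a0 where a0: "\<And>n. a0 n \<noteq> 0" "\<And>n. bond_evolution G (W (k n)) *v a0 n = a0 n"
    by metis
  define a where "a n = inverse (norm (a0 n)) *\<^sub>R a0 n" for n
  have a: "bond_evolution G (W (k n)) *v a n = a n" for n
    unfolding a_def matrix_vector_mult_scaleR_complex a0(2) ..
  have "norm (a n) = 1" for n
    using a0(1)[of n] by (simp add: a_def)
  then have "\<forall>n. a n \<in> sphere 0 1" by simp
  then obtain a' r where r: "strict_mono r" "(a \<circ> r) \<longlonglongrightarrow> a'" "a' \<in> sphere 0 1"
    using compact_sphere[of "0 :: complex ^ 'b bond" 1]
    unfolding compact_eq_seq_compact_metric seq_compact_def by metis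
  have "\<tau> \<longlonglongrightarrow> 0"
    by (rule Lim_null_comparison[OF _ LIMSEQ_inverse_real_of_nat])
       (use \<tau>(1) in \<open>auto intro!: always_eventually less_imp_le\<close>)
  have "(\<lambda>n. W (t n)) \<longlonglongrightarrow> w"
    by (rule metric_tendsto_imp_tendsto[OF LIMSEQ_inverse_real_of_nat])
       (use t(2) in \<open>auto intro!: always_eventually less_imp_le\<close>)
  have "(\<lambda>n. W (k n)) \<longlonglongrightarrow> w"
  proof (rule vec_tendstoI)
    fix e
    have "(\<lambda>n. W (t n) $ e * cis (\<tau> n * len G e)) \<longlonglongrightarrow> w $ e * cis (0 * len G e)"
      by (intro tendsto_intros tendsto_vec_nth \<open>\<tau> \<longlonglongrightarrow> 0\<close> \<open>(\<lambda>n. W (t n)) \<longlonglongrightarrow> w\<close>)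
    moreover have "W (t n) $ e * cis (\<tau> n * len G e) = W (k n) $ e" for n
      by (simp add: W_def k_def cis_mult distrib_right)
    ultimately show "(\<lambda>n. W (k n) $ e) \<longlonglongrightarrow> w $ e" by simp
  qed
  then have "(\<lambda>n. bond_evolution G ((W \<circ> k \<circ> r) n) *v (a \<circ> r) n) \<longlonglongrightarrow> bond_evolution G w *v a'"
    using LIMSEQ_subseq_LIMSEQ[OF _ r(1), of "W \<circ> k"] r(2)
    by (intro bond_evolution_tendsto) (simp_all add: comp_def)
  then have "(a \<circ> r) \<longlonglongrightarrow> bond_evolution G w *v a'"
    by (simp add: a comp_def)
  then have a': "U_B G \<theta> *v a' = a'"
    using LIMSEQ_unique r(2) by (auto simp: U_B_eq_bond_evolution w_def)
  have "filterlim k at_top sequentially"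
  \<comment> \<open>The correction is smaller than 1, so \<open>k n\<close> exceeds
    \<open>n - 1\<close>.\<close>
  proof (rule filterlim_at_top_mono)
    show "filterlim (\<lambda>n. - 1 + real n) at_top sequentially"
      by (rule filterlim_tendsto_add_at_top[OF tendsto_const filterlim_real_sequentially])
    show "\<forall>\<^sub>F n in sequentially. - 1 + real n \<le> k n"
    proof (intro always_eventually allI)
      fix n
      have "inverse (real (Suc n)) \<le> 1" by (simp add: inverse_le_1_iff)
      then show "- 1 + real n \<le> k n"
        using t(1)[of n] \<tau>(1)[of n] by (simp add: k_def)
    qed
  qed
  then have "filterlim (k \<circ> r) at_top sequentially"
    unfolding comp_def by (rule filterlim_compose[OF _ filterlim_subseq[OF r(1)]])
  then show ?thesis
  proof (rule that)
    show "bond_evolution G (\<chi> e. cis ((k \<circ> r) n * len G e)) *v (a \<circ> r) n = (a \<circ> r) n" for n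
      using a[of "r n"] by (simp add: W_def)
    show "norm a' = 1" using r(3) by simp
  qed (fact r(2) a')+
qed


section \<open>Waves on the graph\<close>

text \<open>By \<open>a = D S\<^sub>B a\<close>, the entry \<open>a_b\<close> is the amplitude with which the wave on the bond \<open>b\<close>
  arrives at the terminus of \<open>b\<close>.\<close>

definition wave ::
  "('v, 'e::finite) quantum_graph \<Rightarrow> real \<Rightarrow> complex ^ 'e bond \<Rightarrow> 'e \<Rightarrow> real \<Rightarrow> complex" where
  "wave G k a e x = a $ (e, True) * cis (k * (x - len G e)) + a $ (e, False) * cis (- (k * x))"

definition wave_deriv ::
  "('v, 'e::finite) quantum_graph \<Rightarrow> real \<Rightarrow> complex ^ 'e bond \<Rightarrow> 'e \<Rightarrow> real \<Rightarrow> complex" where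
  "wave_deriv G k a e x =
     \<i> * k * (a $ (e, True) * cis (k * (x - len G e)) - a $ (e, False) * cis (- (k * x)))"

lemma has_vector_derivative_cis:
  assumes "(f has_real_derivative d) (at x within A)"
  shows "((\<lambda>x. cis (f x)) has_vector_derivative \<i> * d * cis (f x)) (at x within A)"
  using has_derivative_cis[of f "(*) d" x A] assms
  by (simp add: has_vector_derivative_def has_field_derivative_def scaleR_conv_of_real mult_ac)

lemma wave_has_vector_derivative:
  "(wave G k a e has_vector_derivative wave_deriv G k a e x) (at x within A)"
  unfolding wave_def[abs_def] wave_deriv_def
  by (rule derivative_eq_intros has_vector_derivative_cis refl)+ (simp add: algebra_simps)

lemma wave_deriv_has_vector_derivative:
  "(wave_deriv G k a e has_vector_derivative - (of_real (k\<^sup>2) * wave G k a e x)) (at x within A)"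
  unfolding wave_def wave_deriv_def[abs_def]
  by (rule derivative_eq_intros has_vector_derivative_cis refl)+
     (simp add: algebra_simps power2_eq_square)

lemma continuous_on_wave [continuous_intros]:
  "continuous_on A f \<Longrightarrow> continuous_on A (\<lambda>x. wave G k a e (f x))"
  unfolding wave_def by (intro continuous_intros)

lemma H2_edge_wave:
  "H2_edge L (wave G k a e) (wave_deriv G k a e) (\<lambda>x. - (of_real (k\<^sup>2) * wave G k a e x))"
  unfolding H2_edge_def
proof (intro conjI ballI)
  let ?f2 = "\<lambda>x. - (of_real (k\<^sup>2) * wave G k a e x)"
  have cont: "continuous_on A ?f2" for A
    by (intro continuous_intros)
  show "set_borel_measurable lborel {0..L} ?f2"
    using borel_integrable_atLeastAtMost'[OF cont]
    by (simp add: set_integrable_def set_borel_measurable_def borel_measurable_integrable)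
  show "set_integrable lborel {0..L} (\<lambda>x. (cmod (?f2 x))\<^sup>2)"
    by (intro borel_integrable_atLeastAtMost' continuous_intros)
  fix x assume "x \<in> {0..L}"
  then have x: "0 \<le> x" by simp
  show "wave_deriv G k a e x = wave_deriv G k a e 0 + (LINT t:{0..x}|lborel. ?f2 t)"
    using integral_FTC_atLeastAtMost[OF x wave_deriv_has_vector_derivative cont]
    by (simp add: set_lebesgue_integral_def)
  have "continuous_on {0..x} (wave_deriv G k a e)"
    by (rule continuous_on_vector_derivative) (rule wave_deriv_has_vector_derivative)
  then show "wave G k a e x = wave G k a e 0 + (LINT t:{0..x}|lborel. wave_deriv G k a e t)"
    using integral_FTC_atLeastAtMost[OF x wave_has_vector_derivative, of G k a e]
    by (simp add: set_lebesgue_integral_def)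
qed

text \<open>The eigenvalue equation says that the amplitudes leaving a vertex are \<open>S_B\<close>
  applied to those arriving; in terms of values and derivatives this is exactly the vertex
  condition.\<close>

lemma neg_laplacian_wave:
  assumes eig: "bond_evolution G (\<chi> e. cis (k * len G e)) *v a = a"
  shows "neg_laplacian G (wave G k a) (\<lambda>e x. of_real (k\<^sup>2) * wave G k a e x)"
  unfolding neg_laplacian_def
proof (intro exI conjI allI)
  show "H2_edge (len G e) (wave G k a e) (wave_deriv G k a e)
      (\<lambda>x. - (of_real (k\<^sup>2) * wave G k a e x))" for e
    by (rule H2_edge_wave)
  have a: "a $ b = cis (k * len G (fst b)) * (S_B G *v a) $ b" for b
    using bond_evolution_mult[of G "\<chi> e. cis (k * len G e)" a b] by (simp add: eig)
  have S: "(S_B G *v a) $ b = a $ b * cis (- (k * len G (fst b)))" for b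
  proof -
    have "a $ b * cis (- (k * len G (fst b))) =
        (cis (k * len G (fst b)) * cis (- (k * len G (fst b)))) * (S_B G *v a) $ b"
      by (subst a) (simp only: mult_ac)
    then show ?thesis by (simp add: cis_mult)
  qed
  \<comment> \<open>At the origin of \<open>b\<close>, the leaving and arriving amplitudes add in
    the value and subtract in the outgoing derivative.\<close>
  have val: "vertex_value G (wave G k a) b = (S_B G *v a) $ b + a $ rev_bond b" for b
    by (cases b; cases "snd b")
       (simp_all add: vertex_value_def wave_def S rev_bond_def)
  have der: "normal_deriv G (wave_deriv G k a) b = \<i> * k * ((S_B G *v a) $ b - a $ rev_bond b)" for b
    by (cases b; cases "snd b")
       (simp_all add: normal_deriv_def wave_deriv_def S rev_bond_def right_diff_distrib)
  show "vertex_condition G (wave G k a) (wave_deriv G k a) v" for v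
  proof (cases "exterior G v")
    case True
    then show ?thesis
      using S_B_mult_exterior[of G _ a]
      by (cases "bcond G v") (auto simp: vertex_condition_def val der)
  next
    case False
    let ?B = "{b. origin G b = v}" and ?q = "\<lambda>b. a $ rev_bond b"
    \<comment> \<open>\<open>m\<close> is the common value of the wave on all bonds at
      \<open>v\<close>, which gives continuity.\<close>
    define m where "m = 2 / of_nat (card ?B) * sum ?q ?B"
    have S': "(S_B G *v a) $ b = m - ?q b" if "origin G b = v" for b
      using S_B_mult_interior[of G b a] that False by (simp add: vertex_degree_def m_def)
    have "of_nat (card B) * (2 / of_nat (card B) * sum ?q B) = 2 * sum ?q B"
      if "finite B" for B
      using that by (cases "B = {}") simp_all
    from this[of ?B, OF finite] have "of_nat (card ?B) * m = 2 * sum ?q ?B"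
      unfolding m_def .
    moreover have "(\<Sum>b\<in>?B. normal_deriv G (wave_deriv G k a) b) = (\<Sum>b\<in>?B. \<i> * k * (m - 2 * ?q b))"
      by (rule sum.cong) (simp_all add: der S')
    ultimately have "(\<Sum>b\<in>?B. normal_deriv G (wave_deriv G k a) b) = 0"
      by (simp add: sum_subtractf flip: sum_distrib_left)
    then show ?thesis
      using False by (simp add: vertex_condition_def val S')
  qed
qed

lemma wave_scaleR: "wave G k (c *\<^sub>R a) e x = of_real c * wave G k a e x"
  by (simp add: wave_def scaleR_conv_of_real[where 'a = complex] algebra_simps)

text \<open>The squares of the two counter-propagating waves are constant; their relative phase
  \<open>k * (2 * x - len G e)\<close> carries all the oscillation.\<close>

lemma cmod_wave_squared:
  "(cmod (wave G k a e x))\<^sup>2 = edge_intensity a e +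
     2 * Re (a $ (e, True) * cnj (a $ (e, False)) * cis (k * (2 * x - len G e)))"
proof -
  have sq: "(cmod (p + q))\<^sup>2 = (cmod p)\<^sup>2 + (cmod q)\<^sup>2 + 2 * Re (p * cnj q)" for p q
    unfolding cmod_power2 by (simp add: power2_eq_square algebra_simps)
  have cis: "cis (k * (2 * x - len G e)) = cis (k * (x - len G e)) * cnj (cis (- (k * x)))"
    by (simp add: cis_cnj cis_mult algebra_simps)
  have eq: "a $ (e, True) * cis (k * (x - len G e)) * cnj (a $ (e, False) * cis (- (k * x))) =
      a $ (e, True) * cnj (a $ (e, False)) * cis (k * (2 * x - len G e))"
    unfolding cis complex_cnj_mult by (simp only: mult_ac)
  show ?thesis
    unfolding wave_def sq eq edge_intensity_def by (simp add: norm_mult)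
qed


section \<open>Averaging of rapid oscillations\<close>

text \<open>Integration by parts against the antiderivative \<open>c\<close> of the oscillation,
  whose modulus is \<open>1 / (2 * k)\<close>.\<close>

lemma oscillatory_integral_bound:
  fixes p p' :: "real \<Rightarrow> real"
  assumes L: "0 \<le> L" and k: "0 < k"
    and p: "\<And>x. (p has_real_derivative p' x) (at x)" and p': "continuous_on {0..L} p'"
  shows "cmod (LINT x:{0..L}|lborel. of_real (p x) * cis (k * (2 * x - L))) \<le>
    (\<bar>p L\<bar> + \<bar>p 0\<bar> + (LINT x:{0..L}|lborel. \<bar>p' x\<bar>)) / (2 * k)"
proof -
  define c where "c x = cis (k * (2 * x - L)) / (2 * \<i> * k)" for x
  have c': "(c has_vector_derivative cis (k * (2 * x - L))) (at x within A)" for x A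
    unfolding c_def[abs_def] using k
    by (auto intro!: derivative_eq_intros has_vector_derivative_cis simp: field_simps)
  have norm_c: "cmod (c x) = 1 / (2 * k)" for x
    using k by (simp add: c_def norm_divide norm_mult)
  have cont_c: "continuous_on A c" for A
    unfolding c_def by (intro continuous_intros) (use k in auto)
  have cont_p: "continuous_on A p" for A
    using p by (meson DERIV_isCont continuous_at_imp_continuous_on)
  have deriv: "((\<lambda>x. of_real (p x) * c x) has_vector_derivative
      of_real (p x) * cis (k * (2 * x - L)) + of_real (p' x) * c x) (at x within A)" for x A
  proof -
    have "((\<lambda>x. p x *\<^sub>R c x) has_vector_derivative
        p x *\<^sub>R cis (k * (2 * x - L)) + p' x *\<^sub>R c x) (at x within A)"
      by (rule has_vector_derivative_scaleR[OF has_field_derivative_at_within[OF p] c'])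
    then show ?thesis by (simp add: scaleR_conv_of_real)
  qed
  have int: "set_integrable lborel {0..L} (\<lambda>x. of_real (p x) * cis (k * (2 * x - L)))"
    "set_integrable lborel {0..L} (\<lambda>x. of_real (p' x) * c x)"
    by (intro borel_integrable_atLeastAtMost' continuous_intros cont_p cont_c p')+
  have "(LINT x:{0..L}|lborel. of_real (p x) * cis (k * (2 * x - L)) + of_real (p' x) * c x) =
      of_real (p L) * c L - of_real (p 0) * c 0"
    unfolding set_lebesgue_integral_def
    by (rule integral_FTC_atLeastAtMost[OF L deriv]) (intro continuous_intros cont_p cont_c p')
  then have eq: "(LINT x:{0..L}|lborel. of_real (p x) * cis (k * (2 * x - L))) =
      of_real (p L) * c L - of_real (p 0) * c 0 - (LINT x:{0..L}|lborel. of_real (p' x) * c x)"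
    unfolding set_integral_add(2)[OF int] by (simp add: algebra_simps)
  have "cmod (LINT x:{0..L}|lborel. of_real (p' x) * c x) \<le>
      (LINT x:{0..L}|lborel. cmod (of_real (p' x) * c x))"
    using set_integral_norm_bound[OF int(2)] .
  also have "\<dots> = (LINT x:{0..L}|lborel. \<bar>p' x\<bar>) / (2 * k)"
    by (simp add: norm_mult norm_c)
  finally have "cmod (LINT x:{0..L}|lborel. of_real (p' x) * c x) \<le>
      (LINT x:{0..L}|lborel. \<bar>p' x\<bar>) / (2 * k)" .
  moreover have "cmod (of_real (p y) * c y) = \<bar>p y\<bar> / (2 * k)" for y
    by (simp add: norm_mult norm_c)
  ultimately show ?thesis
    unfolding eq add_divide_distrib
    using norm_triangle_ineq4[of "of_real (p L) * c L - of_real (p 0) * c 0"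
        "LINT x:{0..L}|lborel. of_real (p' x) * c x"]
      norm_triangle_ineq4[of "of_real (p L) * c L" "of_real (p 0) * c 0"]
    by simp
qed

text \<open>A uniform polynomial approximation of \<open>g\<close> reduces the claim to the
  differentiable case, with an error independent of the frequency.\<close>

lemma riemann_lebesgue:
  fixes g :: "real \<Rightarrow> real"
  assumes L: "0 \<le> L" and g: "continuous_on {0..L} g" and k: "filterlim k at_top sequentially"
  shows "(\<lambda>n. LINT x:{0..L}|lborel. of_real (g x) * cis (k n * (2 * x - L))) \<longlonglongrightarrow> 0"
proof (rule tendstoI)
  fix e :: real assume e: "e > 0"
  \<comment> \<open>The summand 1 keeps the denominator positive at \<open>L = 0\<close> and the
    inequality \<open>\<epsilon> * L < e / 2\<close> strict.\<close>
  define \<epsilon> where "\<epsilon> = e / (2 * (L + 1))"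
  have \<epsilon>: "\<epsilon> > 0" "\<epsilon> * L < e / 2"
    using e L by (simp_all add: \<epsilon>_def field_simps)
  obtain p where poly: "real_polynomial_function p"
    and p: "\<And>x. x \<in> {0..L} \<Longrightarrow> \<bar>g x - p x\<bar> < \<epsilon>"
    using Stone_Weierstrass_real_polynomial_function[OF compact_Icc g \<epsilon>(1)] by blast
  obtain p' where p': "real_polynomial_function p'" "\<And>x. (p has_real_derivative p' x) (at x)"
    using has_real_derivative_polynomial_function[OF poly] by blast
  have cont: "continuous_on A p" "continuous_on A p'" for A
    using poly p'(1) continuous_on_polymonial_function
    by (auto simp: real_polynomial_function_eq)
  define C where "C = \<bar>p L\<bar> + \<bar>p 0\<bar> + (LINT x:{0..L}|lborel. \<bar>p' x\<bar>)"
  have "(\<lambda>n. C / (2 * k n)) \<longlonglongrightarrow> 0"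
    by (intro real_tendsto_divide_at_top[OF tendsto_const] filterlim_tendsto_pos_mult_at_top[OF tendsto_const _ k])
       simp
  then have "\<forall>\<^sub>F n in sequentially. C / (2 * k n) < e / 2"
    using e by (intro order_tendstoD(2)) auto
  moreover have "\<forall>\<^sub>F n in sequentially. 0 < k n"
    using k by (simp add: filterlim_at_top_dense)
  ultimately show "\<forall>\<^sub>F n in sequentially.
      dist (LINT x:{0..L}|lborel. of_real (g x) * cis (k n * (2 * x - L))) 0 < e"
  proof eventually_elim
    case (elim n)
    let ?c = "\<lambda>x. cis (k n * (2 * x - L))"
    have int: "set_integrable lborel {0..L} (\<lambda>x. of_real (g x - p x) * ?c x)"
      "set_integrable lborel {0..L} (\<lambda>x. of_real (p x) * ?c x)"
      by (intro borel_integrable_atLeastAtMost' continuous_intros g cont)+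
    have "(LINT x:{0..L}|lborel. of_real (g x) * ?c x) =
        (LINT x:{0..L}|lborel. of_real (g x - p x) * ?c x) +
        (LINT x:{0..L}|lborel. of_real (p x) * ?c x)"
      unfolding set_integral_add(2)[OF int, symmetric] by (simp add: algebra_simps)
    moreover have "cmod (LINT x:{0..L}|lborel. of_real (p x) * ?c x) \<le> C / (2 * k n)"
      unfolding C_def by (rule oscillatory_integral_bound[OF L elim(2) p'(2) cont(2)])
    moreover have "cmod (LINT x:{0..L}|lborel. of_real (g x - p x) * ?c x) \<le> \<epsilon> * L"
    proof -
      have "cmod (LINT x:{0..L}|lborel. of_real (g x - p x) * ?c x) \<le>
          (LINT x:{0..L}|lborel. cmod (of_real (g x - p x) * ?c x))"
        by (rule set_integral_norm_bound[OF int(1)])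
      also have "\<dots> \<le> (LINT x:{0..L}|lborel. \<epsilon>)"
        using p by (intro set_integral_mono borel_integrable_atLeastAtMost' continuous_intros g cont)
          (auto simp: norm_mult less_imp_le simp flip: of_real_diff)
      also have "\<dots> = \<epsilon> * L"
        using L by (simp add: set_lebesgue_integral_def)
      finally show ?thesis .
    qed
    ultimately show ?case
      using elim(1) \<epsilon>(2)
        norm_triangle_ineq[of "LINT x:{0..L}|lborel. of_real (g x - p x) * ?c x"
          "LINT x:{0..L}|lborel. of_real (p x) * ?c x"]
      by simp
  qed
qed

text \<open>The interference term is a convergent coefficient times an integral tending to 0, so
  only the intensity survives. Taking \<open>g\<close> constant gives norms, and \<open>g\<close> a
  test function gives weak limits.\<close>

lemma wave_energy_tendsto:
  assumes len: "0 \<le> len G e" and k: "filterlim k at_top sequentially" and a: "a \<longlonglongrightarrow> a'"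
    and g: "continuous_on {0..len G e} g"
  shows "(\<lambda>n. LINT x:{0..len G e}|lborel. (cmod (wave G (k n) (a n) e x))\<^sup>2 * g x) \<longlonglongrightarrow>
    edge_intensity a' e * (LINT x:{0..len G e}|lborel. g x)"
proof -
  let ?L = "len G e"
  let ?c = "\<lambda>n. a n $ (e, True) * cnj (a n $ (e, False))"
  let ?I = "\<lambda>n. LINT x:{0..?L}|lborel. of_real (g x) * cis (k n * (2 * x - ?L))"
  have "(LINT x:{0..?L}|lborel. (cmod (wave G (k n) (a n) e x))\<^sup>2 * g x) =
      edge_intensity (a n) e * (LINT x:{0..?L}|lborel. g x) + 2 * Re (?c n * ?I n)" for n
  proof -
    let ?f = "\<lambda>x. ?c n * (of_real (g x) * cis (k n * (2 * x - ?L)))"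
    have int: "set_integrable lborel {0..?L} g" "set_integrable lborel {0..?L} ?f"
      by (intro borel_integrable_atLeastAtMost' continuous_intros g)+
    have Re_int: "set_integrable lborel {0..?L} (\<lambda>x. 2 * Re (?f x))"
      by (intro borel_integrable_atLeastAtMost' continuous_intros g)
    have "?c n * ?I n = (LINT x:{0..?L}|lborel. ?f x)"
      by (rule set_integral_mult_right[symmetric])
    moreover have "Re (LINT x:{0..?L}|lborel. ?f x) = (LINT x:{0..?L}|lborel. Re (?f x))"
      using integral_Re[of lborel "\<lambda>x. indicator {0..?L} x *\<^sub>R ?f x"] int(2)
      unfolding set_integrable_def set_lebesgue_integral_def
      by (simp only: scaleR_complex.sel real_scaleR_def)
    moreover have "(cmod (wave G (k n) (a n) e x))\<^sup>2 * g x =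
        edge_intensity (a n) e * g x + 2 * Re (?f x)" for x
      unfolding cmod_wave_squared by (simp add: algebra_simps)
    ultimately show ?thesis
      using int(1) Re_int by (simp only: set_integral_add(2) set_integral_mult_right set_integrable_mult_right)
  qed
  moreover have "(\<lambda>n. edge_intensity (a n) e * (LINT x:{0..?L}|lborel. g x) + 2 * Re (?c n * ?I n))
      \<longlonglongrightarrow> edge_intensity a' e * (LINT x:{0..?L}|lborel. g x) +
        2 * Re (a' $ (e, True) * cnj (a' $ (e, False)) * 0)"
    unfolding edge_intensity_def
    by (intro tendsto_intros tendsto_vec_nth a riemann_lebesgue[OF len g k])
  ultimately show ?thesis by simp
qed


section \<open>Integration on the graph\<close>

text \<open>Fubini for counting measure times Lebesgue measure: finitely many edges turn the outer
  integral into a sum.\<close>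

lemma
  fixes f :: "'a::finite \<Rightarrow> real \<Rightarrow> real"
  assumes f: "\<And>e. integrable lborel (f e)"
  shows borel_measurable_count_space_pair:
      "(\<lambda>(e, x). f e x) \<in> borel_measurable (count_space UNIV \<Otimes>\<^sub>M lborel)"
    and integral_count_space_pair:
      "(LINT p|(count_space UNIV \<Otimes>\<^sub>M lborel). (\<lambda>(e, x). f e x) p) = (\<Sum>e\<in>UNIV. LINT x|lborel. f e x)"
proof -
  interpret C: sigma_finite_measure "count_space (UNIV :: 'a set)"
    by (rule sigma_finite_measure_count_space_finite) simp
  interpret pair_sigma_finite "count_space (UNIV :: 'a set)" "lborel :: real measure" ..
  show meas: "(\<lambda>(e, x). f e x) \<in> borel_measurable (count_space UNIV \<Otimes>\<^sub>M lborel)"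
    by (rule measurable_pair_measure_countable1)
       (use f in \<open>auto intro: borel_measurable_integrable\<close>)
  have "integrable (count_space UNIV \<Otimes>\<^sub>M lborel) (\<lambda>(e, x). f e x)"
    by (rule Fubini_integrable[OF meas]) (use f in \<open>auto intro: integrable_count_space\<close>)
  from integral_fst'[OF this]
  show "(LINT p|(count_space UNIV \<Otimes>\<^sub>M lborel). (\<lambda>(e, x). f e x) p) = (\<Sum>e\<in>UNIV. LINT x|lborel. f e x)"
    by (simp add: lebesgue_integral_count_space_finite)
qed

lemma continuous_map_imp_borel_measurable:
  assumes "continuous_map X euclideanreal \<phi>"
  shows "\<phi> \<in> borel_measurable (borel_of_topology X)"
proof (rule borel_measurableI)
  have sub: "{U. openin X U} \<subseteq> Pow (topspace X)"
    using openin_subset by blast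
  fix S :: "real set" assume "open S"
  then have "openin X {x \<in> topspace X. \<phi> x \<in> S}"
    using assms by (simp add: continuous_map_def)
  moreover have "\<phi> -` S \<inter> topspace X = {x \<in> topspace X. \<phi> x \<in> S}" by auto
  ultimately show "\<phi> -` S \<inter> space (borel_of_topology X) \<in> sets (borel_of_topology X)"
    unfolding borel_of_topology_def space_measure_of[OF sub] sets_measure_of[OF sub]
    by (auto intro: sigma_sets.Basic)
qed

lemma continuous_map_edge_point:
  assumes "continuous_map (graph_topology G) euclideanreal \<phi>"
  shows "continuous_on {0..len G e} (\<lambda>x. \<phi> (edge_point G e x))"
proof -
  have "continuous_map (top_of_set {0..len G e}) (graph_topology G) (edge_point G e)"
    unfolding continuous_map_def
    using edge_point_in_graph_points[of _ G e] by (auto simp: openin_graph_topology)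
  from continuous_map_compose[OF this assms] show ?thesis
    by (simp add: continuous_map_iff_continuous comp_def)
qed

text \<open>Undoing the push-forward, the density and the restriction in turn leaves a product
  integral, which Fubini splits into edges.\<close>

lemma integral_density_on_graph:
  fixes G :: "('v, 'e::finite) quantum_graph"
  assumes \<rho>: "\<And>e. continuous_on {0..len G e} (\<rho> e)" and nonneg: "\<And>e x. \<rho> e x \<ge> 0"
    and \<phi>: "continuous_map (graph_topology G) euclideanreal \<phi>"
  shows "(LINT p|density_on_graph G \<rho>. \<phi> p) =
    (\<Sum>e\<in>UNIV. LINT x:{0..len G e}|lborel. \<rho> e x * \<phi> (edge_point G e x))"
proof -
  let ?P = "count_space UNIV \<Otimes>\<^sub>M lborel :: ('e \<times> real) measure"
  let ?\<Omega> = "SIGMA e:UNIV. {0..len G e}"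
  let ?\<psi> = "\<lambda>(e, x). \<phi> (edge_point G e x)"
  have "?\<Omega> = (\<Union>e. {e} \<times> {0..len G e})"
    by auto
  also have "\<dots> \<in> sets ?P"
    by (intro sets.finite_UN pair_measureI) auto
  finally have \<Omega>: "?\<Omega> \<inter> space ?P \<in> sets ?P"
    by simp
  have ind: "indicator ?\<Omega> (e, x) = (indicator {0..len G e} x :: real)" for e x
    by (simp add: indicator_def)
  have ind_\<rho>: "(\<lambda>p. indicator ?\<Omega> p *\<^sub>R (\<lambda>(e, x). \<rho> e x) p) =
      (\<lambda>(e, x). indicator {0..len G e} x *\<^sub>R \<rho> e x)"
    by (auto simp: fun_eq_iff ind)
  \<comment> \<open>Continuity is known only on the closed edges, so measurability is checked for
    the extension by zero.\<close>
  have \<rho>_meas: "(\<lambda>(e, x). \<rho> e x) \<in> borel_measurable (edges_lborel G)"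
    unfolding edges_lborel_def borel_measurable_restrict_space_iff[OF \<Omega>] ind_\<rho>
    using borel_integrable_atLeastAtMost'[OF \<rho>]
    by (intro borel_measurable_count_space_pair) (simp add: set_integrable_def)
  have \<phi>_meas: "\<phi> \<in> borel_measurable (borel_of_topology (graph_topology G))"
    by (rule continuous_map_imp_borel_measurable[OF \<phi>])
  have \<psi>_meas: "?\<psi> \<in> borel_measurable (edges_lborel G)"
    using measurable_comp[OF edge_point_measurable \<phi>_meas] by (simp add: comp_def split_beta')
  have "(LINT p|density_on_graph G \<rho>. \<phi> p) =
      (LINT p|density (edges_lborel G) (\<lambda>(e, x). ennreal (\<rho> e x)). ?\<psi> p)"
    unfolding density_on_graph_def
    by (subst integral_distr[OF _ \<phi>_meas])
       (use edge_point_measurable[of G] in \<open>simp_all add: split_beta'\<close>)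
  also have "\<dots> = (LINT p|edges_lborel G. (\<lambda>(e, x). \<rho> e x) p *\<^sub>R ?\<psi> p)"
    using integral_density[OF \<psi>_meas \<rho>_meas] nonneg by (simp add: split_beta')
  also have "\<dots> = (LINT p|?P. indicator ?\<Omega> p *\<^sub>R ((\<lambda>(e, x). \<rho> e x) p *\<^sub>R ?\<psi> p))"
    unfolding edges_lborel_def by (rule integral_restrict_space[OF \<Omega>])
  also have "\<dots> = (LINT p|?P. (\<lambda>(e, x). indicator {0..len G e} x *\<^sub>R (\<rho> e x * \<phi> (edge_point G e x))) p)"
    by (rule Bochner_Integration.integral_cong) (auto simp: ind)
  also have "\<dots> = (\<Sum>e\<in>UNIV. LINT x:{0..len G e}|lborel. \<rho> e x * \<phi> (edge_point G e x))"
    unfolding set_lebesgue_integral_def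
  proof (rule integral_count_space_pair)
    fix e
    have "set_integrable lborel {0..len G e} (\<lambda>x. \<rho> e x * \<phi> (edge_point G e x))"
      by (intro borel_integrable_atLeastAtMost' continuous_on_mult \<rho> continuous_map_edge_point \<phi>)
    then show "integrable lborel
        (\<lambda>x. indicator {0..len G e} x *\<^sub>R (\<rho> e x * \<phi> (edge_point G e x)))"
      by (simp add: set_integrable_def)
  qed
  finally show ?thesis .
qed


section \<open>Concentration on the primitive subgraph\<close>

lemma edge_intensity_scaleR: "edge_intensity (c *\<^sub>R a) e = c\<^sup>2 * edge_intensity a e"
  by (simp add: edge_intensity_def power_mult_distrib distrib_left)

lemma edge_intensity_scale: "edge_intensity (c *s a) e = (cmod c)\<^sup>2 * edge_intensity a e"
  by (simp add: edge_intensity_def norm_mult power_mult_distrib distrib_left)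

lemma edge_intensity_nonneg: "0 \<le> edge_intensity a e"
  by (simp add: edge_intensity_def)

lemma L2_norm_squared:
  "(L2_norm G F u)\<^sup>2 = (\<Sum>e\<in>F. LINT x:{0..len G e}|lborel. (cmod (u e x))\<^sup>2)"
proof -
  have "0 \<le> (LINT x:{0..len G e}|lborel. (cmod (u e x))\<^sup>2)" for e
    unfolding set_lebesgue_integral_def by (rule integral_nonneg_AE) simp
  then show ?thesis by (simp add: L2_norm_def sum_nonneg)
qed

lemma L2_norm_wave_scaleR: "L2_norm G F (wave G k (c *\<^sub>R a)) = \<bar>c\<bar> * L2_norm G F (wave G k a)"
proof (rule power2_eq_imp_eq)
  show "(L2_norm G F (wave G k (c *\<^sub>R a)))\<^sup>2 = (\<bar>c\<bar> * L2_norm G F (wave G k a))\<^sup>2"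
    unfolding L2_norm_squared power_mult_distrib
    by (simp add: wave_scaleR norm_mult power_mult_distrib sum_distrib_left)
qed (simp_all add: L2_norm_def sum_nonneg set_lebesgue_integral_def)

lemma L2_norm_wave_tendsto:
  assumes "metric_graph G" "filterlim k at_top sequentially" "a \<longlonglongrightarrow> a'"
  shows "(\<lambda>n. L2_norm G F (wave G (k n) (a n))) \<longlonglongrightarrow>
    sqrt (\<Sum>e\<in>F. edge_intensity a' e * len G e)"
proof -
  have len: "0 \<le> len G e" for e
    using assms(1) by (simp add: metric_graph_def less_imp_le)
  have "(\<lambda>n. LINT x:{0..len G e}|lborel. (cmod (wave G (k n) (a n) e x))\<^sup>2) \<longlonglongrightarrow>
      edge_intensity a' e * len G e" for e
    using wave_energy_tendsto[OF len assms(2,3), where g = "\<lambda>_. 1" and e = e] len[of e]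
    by (simp add: set_lebesgue_integral_def)
  then show ?thesis
    unfolding L2_norm_def by (intro tendsto_real_sqrt tendsto_sum)
qed

text \<open>Simplicity makes every eigenvector a nonzero multiple of the one supported on
  \<open>K\<close>; two independent eigenvectors would force dimension at least 2.\<close>

lemma R_set_eigenvector_support:
  assumes R: "\<theta> \<in> R_set G K" and eig: "U_B G \<theta> *v a = a" and nz: "a \<noteq> 0"
  shows "edge_intensity a e > 0 \<longleftrightarrow> e \<in> K"
proof -
  let ?V = "{a. U_B G \<theta> *v a = a}"
  obtain b where b: "b \<noteq> 0" "U_B G \<theta> *v b = b" "\<And>e. edge_intensity b e > 0 \<longleftrightarrow> e \<in> K"
    using R unfolding R_set_def by blast
  have "\<exists>c. a = c *s b"
  proof (rule ccontr)
    assume no: "\<nexists>c. a = c *s b"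
    then have "a \<notin> vec.span {b}"
      by (auto simp: vec.span_singleton)
    then have "vec.independent {a, b}"
      using b(1) by (simp add: vec.independent_insert)
    moreover have "a \<noteq> b"
      using no by (metis vec.scale_one)
    ultimately have "2 \<le> vec.dim ?V"
      using vec.independent_card_le_dim[of "{a, b}" ?V] eig b(2) by simp
    with R show False by (simp add: R_set_def)
  qed
  then obtain c where c: "a = c *s b" by blast
  with nz have "c \<noteq> 0" by auto
  then show ?thesis
    using b(3)[of e] by (simp add: c edge_intensity_scale zero_less_mult_iff)
qed

theorem theorem1p1:
  fixes G :: "('v::finite, 'e::finite) quantum_graph" and K :: "'e set"
  assumes "metric_graph G"
    and "primitive_subgraph G K" and "K \<noteq> UNIV"
    and "RAC G K"
  shows "\<exists>(k :: nat \<Rightarrow> real) (u :: nat \<Rightarrow> 'e \<Rightarrow> real \<Rightarrow> complex).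
     filterlim k at_top sequentially \<and>
     (\<forall>n. L2_norm G UNIV (u n) = 1) \<and>
     (\<forall>n. eigenfunction G ((k n)\<^sup>2) (u n)) \<and>
     (\<lambda>n. L2_norm G (- K) (u n)) \<longlonglongrightarrow> 0 \<and>
     weakly_converges (graph_topology G)
       (\<lambda>n. density_on_graph G (\<lambda>e x. (cmod (u n e x))\<^sup>2))
       (density_on_graph G (\<lambda>e x. if e \<in> K then 1 / total_length G K else 0))"
proof -
  have len: "0 < len G e" for e
    using assms(1) by (simp add: metric_graph_def)
  obtain \<theta> where H: "\<theta> \<in> H_set G" and R: "\<theta> \<in> R_set G K"
    using assms(4) by (auto simp: RAC_def)
  then have "\<theta> \<in> Z_B G" by (simp add: R_set_def)
  obtain k0 a0 a' where k0: "filterlim k0 at_top sequentially"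
    and eig: "\<And>n. bond_evolution G (\<chi> e. cis (k0 n * len G e)) *v a0 n = a0 n"
    and lim: "a0 \<longlonglongrightarrow> a'" and norm: "norm a' = 1" and eig': "U_B G \<theta> *v a' = a'"
    using eigenvector_sequence[OF assms(1) H \<open>\<theta> \<in> Z_B G\<close>] by metis
  have "a' \<noteq> 0" using norm by auto
  note supp = R_set_eigenvector_support[OF R eig' this]
  have off: "edge_intensity a' e = 0" if "e \<notin> K" for e
    using supp[of e] that edge_intensity_nonneg[of a' e] by linarith
  obtain c where on: "\<And>e. e \<in> K \<Longrightarrow> edge_intensity a' e = c" and "K \<noteq> {}"
  proof (rule edge_intensity_const_on_primitive_subgraph[OF assms(2)])
    show "bond_evolution G (\<chi> e. cis_angle (\<theta> $ e)) *v a' = a'"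
      using eig' by (simp add: U_B_eq_bond_evolution)
  qed (simp_all add: norm_cis_angle off that)
  have "c > 0" using on supp \<open>K \<noteq> {}\<close> by fastforce
  have L: "total_length G K > 0"
    unfolding total_length_def using len \<open>K \<noteq> {}\<close> by (intro sum_pos) auto
  define N where "N n = L2_norm G UNIV (wave G (k0 n) (a0 n))" for n
  \<comment> \<open>\<open>M\<close> is the limit of the norms, as the limiting intensity is
    \<open>c\<close> on \<open>K\<close> and 0 elsewhere.\<close>
  define M where "M = sqrt (c * total_length G K)"
  have "M > 0" using \<open>c > 0\<close> L by (simp add: M_def)
  have "(\<Sum>e\<in>UNIV. edge_intensity a' e * len G e) = (\<Sum>e\<in>K. edge_intensity a' e * len G e)"
    using off by (intro sum.mono_neutral_right) auto
  also have "\<dots> = c * total_length G K"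
    by (simp add: on total_length_def sum_distrib_left)
  finally have N: "N \<longlonglongrightarrow> M"
    using L2_norm_wave_tendsto[OF assms(1) k0 lim, of UNIV] by (simp add: N_def[abs_def] M_def)
  then have "eventually (\<lambda>n. N n > 0) sequentially"
    using \<open>M > 0\<close> by (rule order_tendstoD)
  \<comment> \<open>Dropping the first \<open>n0\<close> terms makes the normalisation legitimate
    for every index.\<close>
  then obtain n0 where n0: "\<And>n. n \<ge> n0 \<Longrightarrow> N n > 0"
    by (auto simp: eventually_sequentially)
  define k where "k n = k0 (n + n0)" for n
  define b where "b n = inverse (N (n + n0)) *\<^sub>R a0 (n + n0)" for n
  define b' where "b' = inverse M *\<^sub>R a'"
  have k: "filterlim k at_top sequentially"
    unfolding k_def[abs_def] by (rule filterlim_compose[OF k0 filterlim_add_const_nat_at_top])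
  have b: "b \<longlonglongrightarrow> b'"
    unfolding b_def[abs_def] b'_def
    by (intro tendsto_intros LIMSEQ_ignore_initial_segment N lim) (use \<open>M > 0\<close> in simp)
  \<comment> \<open>Normalisation divides the intensity \<open>c\<close> by the square of
    \<open>M\<close>, which leaves the uniform density on \<open>K\<close>.\<close>
  have int: "edge_intensity b' e = (if e \<in> K then 1 / total_length G K else 0)" for e
    using \<open>c > 0\<close> L
    by (simp add: b'_def edge_intensity_scaleR on off M_def power_inverse field_simps)
  have unit: "L2_norm G UNIV (wave G (k n) (b n)) = 1" for n
    using n0[of "n + n0"] by (simp add: b_def L2_norm_wave_scaleR k_def flip: N_def)
  have "neg_laplacian G (wave G (k n) (b n)) (\<lambda>e x. of_real ((k n)\<^sup>2) * wave G (k n) (b n) e x)" for n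
    by (rule neg_laplacian_wave) (simp add: b_def k_def eig matrix_vector_mult_scaleR_complex)
  then have eigf: "eigenfunction G ((k n)\<^sup>2) (wave G (k n) (b n))" for n
    by (simp add: eigenfunction_def unit)
  have outside: "(\<lambda>n. L2_norm G (- K) (wave G (k n) (b n))) \<longlonglongrightarrow> 0"
    using L2_norm_wave_tendsto[OF assms(1) k b, of "- K"] by (simp add: int)
  have "weakly_converges (graph_topology G)
      (\<lambda>n. density_on_graph G (\<lambda>e x. (cmod (wave G (k n) (b n) e x))\<^sup>2))
      (density_on_graph G (\<lambda>e x. if e \<in> K then 1 / total_length G K else 0))"
    unfolding weakly_converges_def
  proof (intro allI impI, elim conjE)
    fix \<phi> assume \<phi>: "continuous_map (graph_topology G) euclideanreal \<phi>"
    have wave: "(LINT p|density_on_graph G (\<lambda>e x. (cmod (wave G (k n) (b n) e x))\<^sup>2). \<phi> p) =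
        (\<Sum>e\<in>UNIV. LINT x:{0..len G e}|lborel.
          (cmod (wave G (k n) (b n) e x))\<^sup>2 * \<phi> (edge_point G e x))" for n
      by (rule integral_density_on_graph[OF _ _ \<phi>]) (auto intro!: continuous_intros)
    \<comment> \<open>By \<open>int\<close> the limit density is the intensity of \<open>b'\<close>,
      so convergence reduces to single edges.\<close>
    have limit: "(LINT p|density_on_graph G
          (\<lambda>e x. if e \<in> K then 1 / total_length G K else 0). \<phi> p) =
        (\<Sum>e\<in>UNIV. edge_intensity b' e * (LINT x:{0..len G e}|lborel. \<phi> (edge_point G e x)))"
      unfolding int set_integral_mult_right[symmetric]
      by (rule integral_density_on_graph[OF _ _ \<phi>]) (use L in auto)
    show "(\<lambda>n. LINT p|density_on_graph G (\<lambda>e x. (cmod (wave G (k n) (b n) e x))\<^sup>2). \<phi> p)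
        \<longlonglongrightarrow> (LINT p|density_on_graph G
          (\<lambda>e x. if e \<in> K then 1 / total_length G K else 0). \<phi> p)"
      unfolding wave limit
      by (intro tendsto_sum wave_energy_tendsto k b continuous_map_edge_point \<phi> less_imp_le len)
  qed
  with k unit eigf outside show ?thesis
    by (intro exI[of _ k] exI[of _ "\<lambda>n. wave G (k n) (b n)"] conjI allI)
qed

end
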